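(* Let $Z=m_1p_1+\dots+m_np_n$ be a fat point subscheme of $\mathbb{P}^2$ supported at distinct points $p_1,\dots,p_n$ which is non-reduced, i.e. $m_i\ge 2$ for at least one $i$. Then $\widehat{\alpha}(I(Z))<5/2$ if and only if $Z$ is of one of the following forms: (a) $Z=2(p_1+\dots+p_r)+(p_{r+1}+\dots+p_{r+s})$ with $r\ge1$, $s\ge0$, and all the points $p_1,\dots,p_{r+s}$ lie on one line; in this case $\widehat{\alpha}(I(Z))=2$; (b) $Z=(p_1+\dots+p_{r+s})+2p_0$ with $r,s\ge1$, where $p_1,\dots,p_r$ lie on a line $L_1$, $p_{r+1},\dots,p_{r+s}$ lie on a different line $L_2$, $p_0=L_1\cap L_2$, and $p_1,\dots,p_{r+s}$ are distinct from $p_0$; in this case $\widehat{\alpha}(I(Z))=2$; (c) $Z=2p_1+p_2+p_3+p_4$ where $p_2,p_3,p_4$ lie on a line not containing $p_1$; in this case $\widehat{\alpha}(I(Z))=7/3$.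
   Context: For a fat point subscheme $Z=m_1p_1+\dots+m_np_n$ of $\mathbb{P}^2$ (distinct points $p_i$, integers $m_i\ge1$), $I(Z)=\bigcap_i I(p_i)^{m_i}\subseteq\mathbb{K}[x_0,x_1,x_2]$, where $I(p_i)$ is the ideal of the point $p_i$. $\alpha(J)$ is the least degree of a nonzero element of a homogeneous ideal $J$, $J^{(m)}$ its $m$-th symbolic power (so $I(Z)^{(m)}=\bigcap_i I(p_i)^{mm_i}$), and $\widehat{\alpha}(J)=\lim_{m\to\infty}\alpha(J^{(m)})/m$ is the Waldschmidt constant. *)

theory Defs
  imports Complex_Main "HOL-Library.Poly_Mapping" "HOL-Library.Product_Plus"
begin

text \<open>Polynomial ring K[x0,x1,x2]: a monomial x0^i x1^j x2^k is the exponent triple (i,j,k);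
  a polynomial is a finitely supported coefficient function on monomials, with the
  convolution product from Poly_Mapping.\<close>

type_synonym mono3 = "nat \<times> nat \<times> nat"
type_synonym 'k poly3 = "mono3 \<Rightarrow>\<^sub>0 'k"
type_synonym 'k pt3 = "'k \<times> 'k \<times> 'k"

definition mdeg :: "mono3 \<Rightarrow> nat" where
  "mdeg m = fst m + fst (snd m) + snd (snd m)"

definition homogeneous_of :: "nat \<Rightarrow> 'k::zero poly3 \<Rightarrow> bool" where
  "homogeneous_of d f \<longleftrightarrow> (\<forall>m\<in>Poly_Mapping.keys f. mdeg m = d)"

definition eval3 :: "'k::comm_ring_1 poly3 \<Rightarrow> 'k pt3 \<Rightarrow> 'k" where
  "eval3 f p = (\<Sum>m\<in>Poly_Mapping.keys f. Poly_Mapping.lookup f m * fst p ^ fst m * fst (snd p) ^ fst (snd m)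
                                      * snd (snd p) ^ snd (snd m))"

definition ideal_gen :: "'k::comm_ring_1 poly3 set \<Rightarrow> 'k poly3 set" where
  "ideal_gen S = {f. \<exists>F g. finite F \<and> F \<subseteq> S \<and> f = (\<Sum>s\<in>F. g s * s)}"

definition ideal_pow :: "'k::comm_ring_1 poly3 set \<Rightarrow> nat \<Rightarrow> 'k poly3 set" where
  "ideal_pow I m = ideal_gen {prod_list xs | xs. length xs = m \<and> set xs \<subseteq> I}"

definition proj_point :: "'k::field pt3 \<Rightarrow> bool" where
  "proj_point p \<longleftrightarrow> p \<noteq> (0,0,0)"

definition proj_eq :: "'k::field pt3 \<Rightarrow> 'k pt3 \<Rightarrow> bool" where
  "proj_eq p q \<longleftrightarrow> (\<exists>c. c \<noteq> 0 \<and> q = (c * fst p, c * fst (snd p), c * snd (snd p)))"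

definition point_ideal :: "'k::field pt3 \<Rightarrow> 'k poly3 set" where
  "point_ideal p = ideal_gen {f. \<exists>d. homogeneous_of d f \<and> eval3 f p = 0}"

text \<open>I(Z)^(k) for Z = sum of mult p * p over p in P, i.e. the intersection of I(p)^(k*mult p).\<close>
definition fat_ideal_sym :: "'k::field pt3 set \<Rightarrow> ('k pt3 \<Rightarrow> nat) \<Rightarrow> nat \<Rightarrow> 'k poly3 set" where
  "fat_ideal_sym P mult k = (\<Inter>p\<in>P. ideal_pow (point_ideal p) (k * mult p))"

text \<open>alpha: least degree of a nonzero element (for homogeneous ideals, of a nonzero form).\<close>
definition alpha :: "'k::field poly3 set \<Rightarrow> nat" where
  "alpha J = (LEAST d. \<exists>f\<in>J. f \<noteq> 0 \<and> homogeneous_of d f)"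

definition waldschmidt :: "'k::field pt3 set \<Rightarrow> ('k pt3 \<Rightarrow> nat) \<Rightarrow> real" where
  "waldschmidt P mult = lim (\<lambda>k. real (alpha (fat_ideal_sym P mult k)) / real k)"

text \<open>Lines of P^2: nonzero coefficient vectors l; p lies on l iff l . p = 0.\<close>
definition on_line :: "'k::field pt3 \<Rightarrow> 'k pt3 \<Rightarrow> bool" where
  "on_line l p \<longleftrightarrow> fst l * fst p + fst (snd l) * fst (snd p) + snd (snd l) * snd (snd p) = 0"

end

theory Submission
  imports Defs "HOL-Computational_Algebra.Polynomial_Factorial"
begin

text \<open>All lower bounds come from one Bezout step: a form of degree \<open>d\<close> with multiplicities \<open>a\<close> and \<open>b\<close> at two
  points, where \<open>a + b > d\<close>, is divisible by the line joining them, and the quotient has lower degree and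
  lower multiplicities on that line only. By induction on \<open>d\<close> this gives
  \<open>n d \<ge> (n - 1) m\<^sub>0 + m\<^sub>1 + \<dots> + m\<^sub>n\<close> if \<open>p\<^sub>1, \<dots>, p\<^sub>n\<close> lie on distinct lines through \<open>p\<^sub>0\<close>, and
  \<open>2 d \<ge> m\<^sub>0 + m\<^sub>1 + m\<^sub>2 + m\<^sub>3\<close> for four points of which no three are collinear.

  If there are two double points and not all points are collinear, the first bound with \<open>n = 2\<close> gives \<open>5/2\<close>.
  If \<open>p\<^sub>0\<close> is the only double point and the remaining points lie on at least three lines through
  \<open>p\<^sub>0\<close>, then either three of them in general position with \<open>p\<^sub>0\<close> give \<open>5/2\<close> by the second bound, or there
  are four on distinct lines through \<open>p\<^sub>0\<close>, giving \<open>5/2\<close> by the first bound with \<open>n = 4\<close>, or \<open>Z\<close> is of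
  form (c).\<close>

section \<open>Evaluation of ternary polynomials in commutative algebras\<close>

text \<open>\<open>h\<close> acts on the coefficients, so one definition covers evaluation at a
  point (\<open>h\<close> the identity), substitution of forms (\<open>h = cst\<close>), restriction
  to a parametrised line and expansion around a point.\<close>

definition ev :: "('k::comm_ring_1 \<Rightarrow> 'a::comm_ring_1) \<Rightarrow> 'k poly3 \<Rightarrow> 'a \<Rightarrow> 'a \<Rightarrow> 'a \<Rightarrow> 'a" where
  "ev h f a b c = (\<Sum>m\<in>Poly_Mapping.keys f.
      h (Poly_Mapping.lookup f m) * a ^ fst m * b ^ fst (snd m) * c ^ snd (snd m))"

locale comm_ring_hom =
  fixes h :: "'a::comm_ring_1 \<Rightarrow> 'b::comm_ring_1"
  assumes hom_one [simp]: "h 1 = 1"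
    and hom_add [simp]: "h (x + y) = h x + h y"
    and hom_mult [simp]: "h (x * y) = h x * h y"
begin

lemma hom_zero [simp]: "h 0 = 0"
  using hom_add[of 0 0] by (metis add.right_neutral add_cancel_left_right)

lemma hom_sum: "h (sum g A) = (\<Sum>x\<in>A. h (g x))"
  by (induction A rule: infinite_finite_induct) auto

lemma hom_power [simp]: "h (x ^ n) = h x ^ n"
  by (induction n) auto

lemma hom_dvd: "x dvd y \<Longrightarrow> h x dvd h y"
  by (auto elim!: dvdE)

lemma ev_superset:
  assumes "finite A" "Poly_Mapping.keys f \<subseteq> A"
  shows "ev h f a b c = (\<Sum>m\<in>A. h (Poly_Mapping.lookup f m) * a ^ fst m * b ^ fst (snd m) * c ^ snd (snd m))"
  unfolding ev_def using assms
  by (intro sum.mono_neutral_left) (auto simp: in_keys_iff)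

lemma ev_zero [simp]: "ev h 0 a b c = 0"
  by (simp add: ev_def)

lemma ev_single [simp]:
  "ev h (Poly_Mapping.single m x) a b c = h x * a ^ fst m * b ^ fst (snd m) * c ^ snd (snd m)"
  by (subst ev_superset[of "{m}"]) auto

lemma ev_one [simp]: "ev h 1 a b c = 1"
  unfolding single_one[symmetric] ev_single by simp

lemma ev_add [simp]: "ev h (f + g) a b c = ev h f a b c + ev h g a b c"
proof -
  let ?A = "Poly_Mapping.keys f \<union> Poly_Mapping.keys g"
  have *: "Poly_Mapping.keys (f + g) \<subseteq> ?A" by (rule keys_add)
  show ?thesis
    by (simp add: ev_superset[of ?A f] ev_superset[of ?A g] ev_superset[of ?A "f+g", OF _ *]
        lookup_add sum.distrib algebra_simps)
qed

lemma ev_sum: "ev h (sum f A) a b c = (\<Sum>x\<in>A. ev h (f x) a b c)"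
  by (induction A rule: infinite_finite_induct) auto

end

lemma poly_mapping_as_sum:
  "f = (\<Sum>m\<in>Poly_Mapping.keys f. Poly_Mapping.single m (Poly_Mapping.lookup f m))"
  by (rule poly_mapping_eqI)
     (auto simp: lookup_sum lookup_single when_def in_keys_iff)

context comm_ring_hom
begin

lemma ev_mult [simp]: "ev h (f * g) a b c = ev h f a b c * ev h g a b c"
proof -
  let ?s = "\<lambda>f m. Poly_Mapping.single m (Poly_Mapping.lookup f m)"
  \<comment> \<open>Both sides of the claim are biadditive in \<open>f\<close> and \<open>g\<close>,
    so comparing them on single monomials is enough.\<close>
  have s: "ev h (?s f m * ?s g n) a b c = ev h (?s f m) a b c * ev h (?s g n) a b c" for m n
    by (simp add: mult_single power_add algebra_simps)
  have "f * g = (\<Sum>m\<in>Poly_Mapping.keys f. ?s f m) * (\<Sum>m\<in>Poly_Mapping.keys g. ?s g m)"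
    by (simp flip: poly_mapping_as_sum)
  also have "\<dots> = (\<Sum>m\<in>Poly_Mapping.keys f. \<Sum>n\<in>Poly_Mapping.keys g. ?s f m * ?s g n)"
    by (rule sum_product)
  also have "ev h \<dots> a b c = (\<Sum>m\<in>Poly_Mapping.keys f. ev h (?s f m) a b c) * (\<Sum>m\<in>Poly_Mapping.keys g. ev h (?s g m) a b c)"
    by (simp only: ev_sum s sum_product)
  also have "\<dots> = ev h (\<Sum>m\<in>Poly_Mapping.keys f. ?s f m) a b c * ev h (\<Sum>m\<in>Poly_Mapping.keys g. ?s g m) a b c"
    by (simp only: ev_sum)
  also have "\<dots> = ev h f a b c * ev h g a b c"
    by (simp flip: poly_mapping_as_sum)
  finally show ?thesis .
qed

lemma comm_ring_hom_ev: "comm_ring_hom (\<lambda>f. ev h f a b c)"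
  by unfold_locales auto

lemma ev_hom: "h (ev g f a b c) = ev (\<lambda>x. h (g x)) f (h a) (h b) (h c)"
  by (simp add: ev_def hom_sum)

text \<open>Congruence modulo \<open>t\<close> is respected by sums and products, hence by
  evaluation. With \<open>t = T\<close> it shows that an expansion around \<open>p\<close> is
  congruent to the value at \<open>p\<close>.\<close>

lemma ev_dvd_diff:
  assumes "t dvd a - a'" "t dvd b - b'" "t dvd c - c'"
  shows "t dvd ev h f a b c - ev h f a' b' c'"
proof -
  have p: "t dvd x ^ n - y ^ n" if "t dvd x - y" for x y and n :: nat
    by (subst power_diff_sumr2) (rule dvd_mult2, rule that)
  have m: "t dvd x * y - x' * y'" if "t dvd x - x'" "t dvd y - y'" for x y x' y'
  proof -
    have "x * y - x' * y' = (x - x') * y + x' * (y - y')" by (simp add: algebra_simps)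
    thus ?thesis using that by simp
  qed
  show ?thesis
    unfolding ev_def sum_subtractf[symmetric]
    by (intro dvd_sum m p assms) auto
qed

end

section \<open>Constants, indeterminates and substitution\<close>

abbreviation cst :: "'k::comm_ring_1 \<Rightarrow> 'k poly3" where
  "cst \<equiv> Poly_Mapping.single 0"

interpretation cst: comm_ring_hom cst
  by unfold_locales (auto simp: single_add mult_single)

text \<open>For the embeddings of constants these rules loop with the simp rules for \<^const>\<open>pCons\<close> and
  \<^const>\<open>Poly_Mapping.single\<close>.\<close>

declare cst.hom_one [simp del] cst.hom_add [simp del] cst.hom_mult [simp del] cst.hom_power [simp del]

definition X0 :: "'k::comm_ring_1 poly3" where "X0 = Poly_Mapping.single (1, 0, 0) 1"
definition X1 :: "'k::comm_ring_1 poly3" where "X1 = Poly_Mapping.single (0, 1, 0) 1"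
definition X2 :: "'k::comm_ring_1 poly3" where "X2 = Poly_Mapping.single (0, 0, 1) 1"

lemma eval3_eq_ev: "eval3 f p = ev (\<lambda>x. x) f (fst p) (fst (snd p)) (snd (snd p))"
  by (simp add: eval3_def ev_def)

lemma (in comm_ring_hom) ev_cst [simp]: "ev h (cst x) a b c = h x"
  by simp

lemma (in comm_ring_hom) ev_X [simp]:
  "ev h X0 a b c = a" "ev h X1 a b c = b" "ev h X2 a b c = c"
  by (simp_all add: X0_def X1_def X2_def)

text \<open>Composition of substitutions, needed to undo a linear change of coordinates and to
  restrict a transformed form to a line.\<close>

lemma (in comm_ring_hom) ev_ev:
  "ev h (ev cst f A B C) a b c = ev h f (ev h A a b c) (ev h B a b c) (ev h C a b c)"
proof -
  interpret e: comm_ring_hom "\<lambda>f. ev h f a b c" by (rule comm_ring_hom_ev)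
  show ?thesis using e.ev_hom[of cst f A B C] by simp
qed

lemma X_power:
  "X0 ^ n = Poly_Mapping.single (n, 0, 0) 1"
  "X1 ^ n = Poly_Mapping.single (0, n, 0) 1"
  "X2 ^ n = Poly_Mapping.single (0, 0, n) 1"
  by (induction n) (auto simp: X0_def X1_def X2_def mult_single simp flip: zero_prod_def)

lemma monomial_eq:
  "Poly_Mapping.single m x = cst x * X0 ^ fst m * X1 ^ fst (snd m) * X2 ^ snd (snd m)"
  by (simp add: X_power mult_single)

lemma ev_X_id: "ev cst f X0 X1 X2 = f"
  unfolding ev_def by (simp flip: monomial_eq poly_mapping_as_sum)

section \<open>Homogeneous polynomials\<close>

lemma mdeg_add: "mdeg (m + n) = mdeg m + mdeg n"
  by (simp add: mdeg_def)

lemma homogeneous_zero [simp]: "homogeneous_of d 0"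
  by (simp add: homogeneous_of_def)

lemma homogeneous_single: "mdeg m = d \<Longrightarrow> homogeneous_of d (Poly_Mapping.single m x)"
  by (auto simp: homogeneous_of_def split: if_splits)

lemma homogeneous_one: "homogeneous_of 0 1"
  by (simp add: homogeneous_of_def mdeg_def)

lemma homogeneous_add: "homogeneous_of d f \<Longrightarrow> homogeneous_of d g \<Longrightarrow> homogeneous_of d (f + g)"
  unfolding homogeneous_of_def using keys_add[of f g] by blast

lemma homogeneous_sum: "(\<And>x. x \<in> A \<Longrightarrow> homogeneous_of d (f x)) \<Longrightarrow> homogeneous_of d (sum f A)"
  by (induction A rule: infinite_finite_induct) (auto intro: homogeneous_add)

lemma homogeneous_mult:
  "homogeneous_of d f \<Longrightarrow> homogeneous_of e g \<Longrightarrow> homogeneous_of (d + e) (f * g)"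
  unfolding homogeneous_of_def
proof
  fix m assume "\<forall>m\<in>Poly_Mapping.keys f. mdeg m = d" "\<forall>m\<in>Poly_Mapping.keys g. mdeg m = e"
    and "m \<in> Poly_Mapping.keys (f * g)"
  moreover from this obtain a b where "m = a + b" "a \<in> Poly_Mapping.keys f" "b \<in> Poly_Mapping.keys g"
    using keys_mult[of f g] by blast
  ultimately show "mdeg m = d + e"
    by (simp add: mdeg_add)
qed

lemma homogeneous_power: "homogeneous_of d f \<Longrightarrow> homogeneous_of (n * d) (f ^ n)"
  by (induction n) (auto intro: homogeneous_mult homogeneous_one)

lemma homogeneous_prod:
  "(\<And>x. x \<in> A \<Longrightarrow> homogeneous_of (d x) (f x)) \<Longrightarrow> homogeneous_of (sum d A) (prod f A)"
  by (induction A rule: infinite_finite_induct) (auto intro: homogeneous_mult homogeneous_one)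

lemma homogeneous_cst: "homogeneous_of 0 (cst x)"
  by (rule homogeneous_single) (simp add: mdeg_def)

lemma homogeneous_ev:
  assumes "homogeneous_of d f" "homogeneous_of 1 a" "homogeneous_of 1 b" "homogeneous_of 1 c"
  shows "homogeneous_of d (ev cst f a b c)"
  unfolding ev_def
proof (rule homogeneous_sum)
  fix m assume "m \<in> Poly_Mapping.keys f"
  hence "d = 0 + fst m * 1 + fst (snd m) * 1 + snd (snd m) * 1"
    using assms(1) by (auto simp: homogeneous_of_def mdeg_def)
  moreover have "homogeneous_of (0 + fst m * 1 + fst (snd m) * 1 + snd (snd m) * 1)
      (cst (Poly_Mapping.lookup f m) * a ^ fst m * b ^ fst (snd m) * c ^ snd (snd m))"
    by (intro homogeneous_mult homogeneous_power homogeneous_cst assms)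
  ultimately show "homogeneous_of d (cst (Poly_Mapping.lookup f m) * a ^ fst m * b ^ fst (snd m) * c ^ snd (snd m))"
    by simp
qed

text \<open>The product type carries no linear order making \<^typ>\<open>'k poly3\<close> an instance of
  \<^class>\<open>idom\<close>; the missing property is transferred from iterated univariate polynomials.\<close>

definition emb :: "'k::comm_ring_1 poly3 \<Rightarrow> 'k poly poly poly" where
  "emb f = ev (\<lambda>x. [:[:[:x:]:]:]) f [:[:[:0, 1:]:]:] [:[:0, 1:]:] [:0, 1:]"

interpretation const3: comm_ring_hom "\<lambda>x::'k::comm_ring_1. [:[:[:x:]:]:]"
  by unfold_locales (auto simp: one_pCons)

declare const3.hom_one [simp del] const3.hom_add [simp del] const3.hom_mult [simp del] const3.hom_power [simp del]

interpretation emb: comm_ring_hom emb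
  unfolding emb_def by (rule const3.comm_ring_hom_ev)

text \<open>Every coefficient of \<open>f\<close> can be read off \<open>emb f\<close>, so
  \<open>emb\<close> is injective. The image of \<open>X2\<close> is the outermost variable, whence
  the order \<open>k\<close>, \<open>j\<close>, \<open>i\<close>.\<close>

lemma coeff_emb: "coeff (coeff (coeff (emb f) k) j) i = Poly_Mapping.lookup f (i, j, k)"
proof -
  have X: "[:0, 1:] ^ n = monom 1 n" for n :: nat by (simp add: monom_altdef)
  have C: "[:x:] ^ n = [:x ^ n:]" for x :: "'z::comm_ring_1" and n
    by (induction n) (auto simp: one_pCons)
  have t: "coeff (coeff (coeff ([:[:[:x:]:]:] * [:[:[:0, 1:]:]:] ^ fst m * [:[:0, 1:]:] ^ fst (snd m)
              * [:0, 1:] ^ snd (snd m)) k) j) i = (if m = (i, j, k) then x else (0 :: 'a))" for x m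
    by (cases m) (simp add: X C coeff_monom_mult smult_monom)
  show ?thesis
    unfolding emb_def ev_def coeff_sum t
    by (simp add: in_keys_iff)
qed

lemma emb_eq_0: "emb f = 0 \<Longrightarrow> f = 0"
  by (rule poly_mapping_eqI) (metis coeff_emb coeff_0 lookup_zero prod.exhaust)

lemma poly3_mult_eq_0:
  fixes f g :: "'k::idom poly3"
  assumes "f * g = 0" shows "f = 0 \<or> g = 0"
proof -
  have "emb f * emb g = 0" by (simp flip: emb.hom_mult add: assms)
  thus ?thesis using emb_eq_0 by auto
qed

lemma poly3_power_eq_0: "f ^ n = 0 \<Longrightarrow> f = 0" for f :: "'k::idom poly3"
  by (induction n) (auto dest: poly3_mult_eq_0)

lemma poly3_prod_eq_0: "finite A \<Longrightarrow> prod f A = 0 \<Longrightarrow> \<exists>x\<in>A. f x = 0" for f :: "'a \<Rightarrow> 'k::idom poly3"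
  by (induction A rule: finite_induct) (auto dest: poly3_mult_eq_0)

section \<open>Multiplicity at a point\<close>

abbreviation c0 :: "'a \<times> 'a \<times> 'a \<Rightarrow> 'a" where "c0 p \<equiv> fst p"
abbreviation c1 :: "'a \<times> 'a \<times> 'a \<Rightarrow> 'a" where "c1 p \<equiv> fst (snd p)"
abbreviation c2 :: "'a \<times> 'a \<times> 'a \<Rightarrow> 'a" where "c2 p \<equiv> snd (snd p)"

abbreviation const4 :: "'k::comm_ring_1 \<Rightarrow> 'k poly poly poly poly" where
  "const4 x \<equiv> [:[:[:[:x:]:]:]:]"

interpretation const4: comm_ring_hom "const4"
  by unfold_locales (auto simp: one_pCons)

declare const4.hom_one [simp del] const4.hom_add [simp del] const4.hom_mult [simp del] const4.hom_power [simp del]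

definition T :: "'k::comm_ring_1 poly poly poly poly" where "T = [:[:[:[:0, 1:]:]:]:]"
definition Y0 :: "'k::comm_ring_1 poly poly poly poly" where "Y0 = [:[:[:0, 1:]:]:]"
definition Y1 :: "'k::comm_ring_1 poly poly poly poly" where "Y1 = [:[:0, 1:]:]"
definition Y2 :: "'k::comm_ring_1 poly poly poly poly" where "Y2 = [:0, 1:]"

text \<open>The multiplicity of \<open>f\<close> at \<open>p\<close> is the \<open>T\<close>-adic order of \<open>f (p + T Y)\<close> for an indeterminate
  direction \<open>Y\<close>. The indeterminate \<open>T\<close> is innermost so that \<open>Y\<close> can be specialised by \<^const>\<open>poly\<close>.\<close>

definition nbhd :: "'k::comm_ring_1 pt3 \<Rightarrow> 'k poly3 \<Rightarrow> 'k poly poly poly poly" where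
  "nbhd p f = ev const4 f (const4 (c0 p) + T * Y0) (const4 (c1 p) + T * Y1) (const4 (c2 p) + T * Y2)"

definition vanishes :: "'k::comm_ring_1 pt3 \<Rightarrow> nat \<Rightarrow> 'k poly3 \<Rightarrow> bool" where
  "vanishes p m f \<longleftrightarrow> T ^ m dvd nbhd p f"

interpretation nbhd: comm_ring_hom "nbhd p" for p :: "'k::comm_ring_1 pt3"
  unfolding nbhd_def by (rule const4.comm_ring_hom_ev)

text \<open>\<open>T\<close> is constant in the three outer variables, so divisibility by it is
  tested on coefficients; these are univariate polynomials, divisible by the indeterminate iff they
  vanish at 0.\<close>

lemma T_dvd_iff:
  "T dvd P \<longleftrightarrow> (\<forall>i j k. poly (coeff (coeff (coeff P i) j) k) 0 = 0)" for P :: "'k::field poly poly poly poly"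
  using poly_eq_0_iff_dvd[of _ "0 :: 'k"] by (simp add: T_def const_poly_dvd_iff)

text \<open>A linear polynomial over a field is prime, and a prime stays prime when further
  indeterminates are adjoined.\<close>

lemma prime_elem_T: "prime_elem (T :: 'k::field poly poly poly poly)"
  unfolding T_def by (intro lift_prime_elem_poly prime_elem_linear_field_poly) simp

lemma T_power_dvd_multD:
  fixes a b :: "'k::field poly poly poly poly"
  assumes "T ^ m dvd a * b" "\<not> T dvd a"
  shows "T ^ m dvd b"
  using prime_power_dvd_multD[OF prime_elem_T assms(1)] assms(2) by (cases "m = 0") auto

section \<open>Linear forms and the effect of cancelling one\<close>

definition lin :: "'k::comm_ring_1 pt3 \<Rightarrow> 'k poly3" where
  "lin l = cst (c0 l) * X0 + cst (c1 l) * X1 + cst (c2 l) * X2"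

lemma (in comm_ring_hom) ev_lin [simp]:
  "ev h (lin l) a b c = h (c0 l) * a + h (c1 l) * b + h (c2 l) * c"
  by (simp add: lin_def del: ev_single)

lemma homogeneous_X: "homogeneous_of 1 X0" "homogeneous_of 1 X1" "homogeneous_of 1 X2"
  unfolding X0_def X1_def X2_def by (rule homogeneous_single; simp add: mdeg_def)+

lemma homogeneous_lin: "homogeneous_of 1 (lin l)"
  unfolding lin_def
  using homogeneous_mult[OF homogeneous_cst homogeneous_X(1), of "c0 l"]
    homogeneous_mult[OF homogeneous_cst homogeneous_X(2), of "c1 l"]
    homogeneous_mult[OF homogeneous_cst homogeneous_X(3), of "c2 l"]
  by (auto intro!: homogeneous_add)

lemma lin_nonzero:
  assumes "proj_point l" shows "lin l \<noteq> 0"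
proof
  assume "lin l = 0"
  hence "Poly_Mapping.lookup (lin l) m = 0" for m by simp
  from this[of "(1,0,0)"] this[of "(0,1,0)"] this[of "(0,0,1)"] have "l = (0,0,0)"
    by (cases l) (auto simp: lin_def X0_def X1_def X2_def mult_single lookup_add lookup_single when_def)
  thus False using assms by (simp add: proj_point_def)
qed

text \<open>Around \<open>p\<close> the form \<open>lin l\<close> expands to
  \<open>l . p + T (l . Y)\<close>. Off the line the constant \<open>l . p\<close> is nonzero, so
  the factor is not divisible by \<open>T\<close>. On the line exactly one \<open>T\<close> splits
  off, because \<open>l\<close> is nonzero. For \<open>m = 0\<close> the truncated
  \<open>m - 1\<close> is harmless.\<close>

lemma vanishes_lin_cancel:
  fixes l p :: "'k::field pt3"
  assumes l: "proj_point l" and v: "vanishes p m (lin l * g)"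
  shows "vanishes p (if on_line l p then m - 1 else m) g"
proof -
  let ?c = "c0 l * c0 p + c1 l * c1 p + c2 l * c2 p"
  define D where "D = const4 (c0 l) * Y0 + const4 (c1 l) * Y1 + const4 (c2 l) * Y2"
  have n: "nbhd p (lin l) = const4 ?c + T * D"
    unfolding nbhd_def const4.ev_lin by (simp add: D_def algebra_simps)
  have d: "T ^ m dvd (const4 ?c + T * D) * nbhd p g"
    using v unfolding vanishes_def by (simp add: n)
  show ?thesis
  proof (cases "on_line l p")
    case True
    hence c: "?c = 0" by (simp add: on_line_def)
    have "\<not> T dvd D"
    proof
      assume "T dvd D"
      hence "poly (coeff (coeff (coeff D i) j) k) 0 = 0" for i j k
        by (simp add: T_dvd_iff)
      \<comment> \<open>These index triples pick the coefficients of \<open>Y0\<close>,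
        \<open>Y1\<close>, \<open>Y2\<close> in \<open>D\<close>, which are the coordinates of
        \<open>l\<close>.\<close>
      from this[of 0 0 1] this[of 0 1 0] this[of 1 0 0] have "l = (0,0,0)"
        by (cases l) (simp add: D_def Y0_def Y1_def Y2_def)
      thus False using l by (simp add: proj_point_def)
    qed
    moreover have "T ^ (m - 1) dvd D * nbhd p g"
    proof (cases m)
      case (Suc n)
      have "T * T ^ n dvd T * (D * nbhd p g)"
        using d by (simp add: Suc c mult.assoc)
      moreover have "(T :: 'k poly poly poly poly) \<noteq> 0" by (simp add: T_def)
      ultimately show ?thesis using Suc by simp
    qed auto
    ultimately show ?thesis
      using True T_power_dvd_multD by (auto simp: vanishes_def)
  next
    case False
    have "\<not> T dvd const4 ?c"
      using False by (auto simp: T_dvd_iff on_line_def intro!: exI[of _ "0::nat"])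
    hence "\<not> T dvd const4 ?c + T * D"
      using dvd_add_left_iff[of T "T * D" "const4 ?c"] by simp
    thus ?thesis
      using False d T_power_dvd_multD by (auto simp: vanishes_def)
  qed
qed

section \<open>Splitting off lines\<close>

text \<open>Specialising the direction \<open>Y\<close> to \<open>q\<close> turns the expansion
  around \<open>p\<close> into the restriction of \<open>f\<close> to the parametrised line
  \<open>p + t q\<close>, with \<open>T\<close> becoming the parameter \<open>t\<close>.\<close>

lemma vanishes_along_line:
  fixes p q :: "'k::comm_ring_1 pt3"
  assumes "vanishes p m f"
  shows "[:0, 1:] ^ m dvd ev (\<lambda>x. [:x:]) f [:c0 p, c0 q:] [:c1 p, c1 q:] [:c2 p, c2 q:]"
proof -
  \<comment> \<open>The variables are substituted from the outermost, \<open>Y2\<close>, inwards;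
    only \<open>T\<close> survives.\<close>
  define s where "s = (\<lambda>P::'k poly poly poly poly. poly (poly (poly P [:[:[:c2 q:]:]:]) [:[:c1 q:]:]) [:c0 q:])"
  interpret s: comm_ring_hom s
    by unfold_locales (auto simp: s_def)
  have s: "s T = [:0, 1:]" "s (const4 x) = [:x:]" "s Y0 = [:c0 q:]" "s Y1 = [:c1 q:]" "s Y2 = [:c2 q:]" for x
    by (simp_all add: s_def T_def Y0_def Y1_def Y2_def)
  have "s (T ^ m) dvd s (nbhd p f)"
    using assms unfolding vanishes_def by (rule s.hom_dvd)
  thus ?thesis
    unfolding nbhd_def s.ev_hom s.hom_power s.hom_add s.hom_mult s by simp
qed

section \<open>Restriction of a form to the line \<open>X2 = 0\<close>\<close>

interpretation const1: comm_ring_hom "\<lambda>x::'k::comm_ring_1. [:x:]"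
  by unfold_locales (auto simp: one_pCons)

declare const1.hom_one [simp del] const1.hom_add [simp del] const1.hom_mult [simp del] const1.hom_power [simp del]

text \<open>On \<open>X2 = 0\<close> a form is a binary form. Setting \<open>X0 = 1\<close> or
  \<open>X1 = 1\<close> loses no coefficient, since the degree determines the exponent that
  disappears.\<close>

lemma coeff_ev_edge:
  fixes g :: "'k::comm_ring_1 poly3"
  assumes g: "homogeneous_of d g" and n: "n \<le> d"
  shows "coeff (ev (\<lambda>x. [:x:]) g 1 [:0, 1:] 0) n = Poly_Mapping.lookup g (d - n, n, 0)"
    and "coeff (ev (\<lambda>x. [:x:]) g [:0, 1:] 1 0) n = Poly_Mapping.lookup g (n, d - n, 0)"
proof -
  have X: "[:0, 1:] ^ n = monom (1::'k) n" for n :: nat by (simp add: monom_altdef)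
  have d: "fst m + fst (snd m) + snd (snd m) = d" if "m \<in> Poly_Mapping.keys g" for m
    using g that by (auto simp: homogeneous_of_def mdeg_def)
  have "coeff (ev (\<lambda>x. [:x:]) g 1 [:0, 1:] 0) n =
      (\<Sum>m\<in>Poly_Mapping.keys g. if m = (d - n, n, 0) then Poly_Mapping.lookup g m else 0)"
    unfolding ev_def coeff_sum
  proof (rule sum.cong)
    fix m assume "m \<in> Poly_Mapping.keys g"
    from d[OF this] show "coeff ([:Poly_Mapping.lookup g m:] * 1 ^ fst m * [:0, 1:] ^ fst (snd m) * 0 ^ snd (snd m)) n
       = (if m = (d - n, n, 0) then Poly_Mapping.lookup g m else 0)"
      by (cases m) (auto simp: X smult_monom power_0_left)
  qed simp
  thus "coeff (ev (\<lambda>x. [:x:]) g 1 [:0, 1:] 0) n = Poly_Mapping.lookup g (d - n, n, 0)"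
    by (simp add: in_keys_iff)
  have "coeff (ev (\<lambda>x. [:x:]) g [:0, 1:] 1 0) n =
      (\<Sum>m\<in>Poly_Mapping.keys g. if m = (n, d - n, 0) then Poly_Mapping.lookup g m else 0)"
    unfolding ev_def coeff_sum
  proof (rule sum.cong)
    fix m assume "m \<in> Poly_Mapping.keys g"
    from d[OF this] show "coeff ([:Poly_Mapping.lookup g m:] * [:0, 1:] ^ fst m * 1 ^ fst (snd m) * 0 ^ snd (snd m)) n
       = (if m = (n, d - n, 0) then Poly_Mapping.lookup g m else 0)"
      by (cases m) (auto simp: X smult_monom power_0_left)
  qed simp
  thus "coeff (ev (\<lambda>x. [:x:]) g [:0, 1:] 1 0) n = Poly_Mapping.lookup g (n, d - n, 0)"
    by (simp add: in_keys_iff)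
qed

lemma homogeneous_divide_X2:
  fixes g :: "'k::comm_ring_1 poly3"
  assumes g: "homogeneous_of d g" "g \<noteq> 0" and z: "\<And>i j. Poly_Mapping.lookup g (i, j, 0) = 0"
  obtains e h where "d = Suc e" "homogeneous_of e h" "g = h * X2"
proof
  have k: "snd (snd m) > 0" if "m \<in> Poly_Mapping.keys g" for m
    using z that by (cases m) (auto simp: in_keys_iff intro!: Nat.gr0I)
  from g(2) obtain m where m: "m \<in> Poly_Mapping.keys g" by (metis keys_eq_empty equals0I poly_mapping_eqI lookup_zero in_keys_iff)
  from k[OF m] g(1) m show d: "d = Suc (d - 1)" by (auto simp: homogeneous_of_def mdeg_def)
  let ?h = "\<Sum>m\<in>Poly_Mapping.keys g. Poly_Mapping.single (fst m, fst (snd m), snd (snd m) - 1) (Poly_Mapping.lookup g m)"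
  show "homogeneous_of (d - 1) ?h"
  proof (intro homogeneous_sum homogeneous_single)
    fix m assume "m \<in> Poly_Mapping.keys g"
    with k[OF this] g(1) show "mdeg (fst m, fst (snd m), snd (snd m) - 1) = d - 1"
      by (auto simp: homogeneous_of_def mdeg_def)
  qed
  have "?h * X2 = (\<Sum>m\<in>Poly_Mapping.keys g. Poly_Mapping.single m (Poly_Mapping.lookup g m))"
    unfolding sum_distrib_right
  proof (rule sum.cong)
    fix m assume "m \<in> Poly_Mapping.keys g"
    from k[OF this] show "Poly_Mapping.single (fst m, fst (snd m), snd (snd m) - 1) (Poly_Mapping.lookup g m) * X2
      = Poly_Mapping.single m (Poly_Mapping.lookup g m)"
      by (cases m) (simp add: X2_def mult_single)
  qed simp
  thus "g = ?h * X2" by (simp flip: poly_mapping_as_sum)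
qed

text \<open>Coefficient vector of the line joining \<open>p\<close> and \<open>q\<close>. It is
  nonzero iff \<open>p\<close> and \<open>q\<close> are linearly independent, so
  \<open>proj_point (cross p q)\<close> also serves as the statement that they are distinct
  points.\<close>

definition cross :: "'k::comm_ring_1 pt3 \<Rightarrow> 'k pt3 \<Rightarrow> 'k pt3" where
  "cross p q = (c1 p * c2 q - c2 p * c1 q, c2 p * c0 q - c0 p * c2 q, c0 p * c1 q - c1 p * c0 q)"

lemma lin_combination:
  "cst a * lin u + cst b * lin v + cst c * lin w =
     lin (a * c0 u + b * c0 v + c * c0 w, a * c1 u + b * c1 v + c * c1 w, a * c2 u + b * c2 v + c * c2 w)"
  by (simp add: lin_def cst.hom_add cst.hom_mult algebra_simps)

text \<open>Bezout for a line: restricted to the line through \<open>p\<close> and \<open>q\<close>, the form \<open>f\<close> becomes a binary form of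
  degree \<open>d\<close> with zeros of order \<open>a\<close> and \<open>b\<close>.\<close>

lemma line_dvd:
  fixes f :: "'k::field poly3"
  assumes f: "homogeneous_of d f" "f \<noteq> 0" and ab: "vanishes p a f" "vanishes q b f" "d < a + b"
    and pq: "proj_point (cross p q)"
  obtains e g where "d = Suc e" "homogeneous_of e g" "f = lin (cross p q) * g"
proof -
  let ?l = "cross p q"
  \<comment> \<open>A third vector making the determinant of \<open>p\<close>, \<open>q\<close>,
    \<open>r\<close> equal to 1.\<close>
  obtain r where r: "c0 ?l * c0 r + c1 ?l * c1 r + c2 ?l * c2 r = 1"
  proof -
    consider "c0 ?l \<noteq> 0" | "c1 ?l \<noteq> 0" | "c2 ?l \<noteq> 0"
      using pq by (cases ?l) (auto simp: proj_point_def)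
    thus ?thesis
      by cases (use that[of "(1 / c0 ?l, 0, 0)"] that[of "(0, 1 / c1 ?l, 0)"] that[of "(0, 0, 1 / c2 ?l)"] in auto)
  qed
  \<comment> \<open>\<open>g\<close> is \<open>f\<close> in the coordinates of the basis
    \<open>p\<close>, \<open>q\<close>, \<open>r\<close>: there \<open>p\<close> and
    \<open>q\<close> are the first two unit vectors and their line is \<open>X2 = 0\<close>.\<close>
  define g where "g = ev cst f (lin (c0 p, c0 q, c0 r)) (lin (c1 p, c1 q, c1 r)) (lin (c2 p, c2 q, c2 r))"
  \<comment> \<open>The three cross products are the rows of the adjugate of the matrix with columns
    \<open>p\<close>, \<open>q\<close>, \<open>r\<close>, which is its inverse as the determinant is
    1.\<close>
  have inv: "ev cst g (lin (cross q r)) (lin (cross r p)) (lin (cross p q)) = f"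
  proof -
    have e: "lin (1, 0, 0) = X0" "lin (0, 1, 0) = X1" "lin (0, 0, 1) = X2"
      by (simp_all add: lin_def)
    show ?thesis
      unfolding g_def cst.ev_ev cst.ev_lin lin_combination
      using r by (simp add: cross_def algebra_simps e ev_X_id)
  qed
  have g: "homogeneous_of d g" unfolding g_def by (intro homogeneous_ev f homogeneous_lin)
  have g0: "g \<noteq> 0" using f(2) inv by auto
  have 1: "[:0, 1:] ^ a dvd ev (\<lambda>x. [:x:]) g 1 [:0, 1:] 0"
    using vanishes_along_line[OF ab(1), of q] unfolding g_def const1.ev_ev const1.ev_lin by simp
  have 2: "[:0, 1:] ^ b dvd ev (\<lambda>x. [:x:]) g [:0, 1:] 1 0"
    using vanishes_along_line[OF ab(2), of p] unfolding g_def const1.ev_ev const1.ev_lin by simp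
  have c: "coeff P n = 0" if "[:0, 1:] ^ m dvd P" "n < m" for P :: "'k poly" and n m
  proof -
    have "monom 1 m dvd P" using that(1) by (simp add: monom_altdef)
    thus ?thesis using that(2) by (auto simp: coeff_monom_mult)
  qed
  have "Poly_Mapping.lookup g (i, j, 0) = 0" for i j
  proof (cases "i + j = d")
    case True
    \<comment> \<open>From \<open>i + j = d < a + b\<close>, either the exponent of
      \<open>X1\<close> is below the order at \<open>p\<close> or that of \<open>X0\<close> is below
      the order at \<open>q\<close>; either way the coefficient vanishes.\<close>
    hence d: "j \<le> d" "i \<le> d" "d - j = i" "d - i = j" and "j < a \<or> i < b" using ab(3) by auto
    from this(5) show ?thesis
    proof
      assume "j < a"
      thus ?thesis using c[OF 1] coeff_ev_edge(1)[OF g d(1)] unfolding d by simp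
    next
      assume "i < b"
      thus ?thesis using c[OF 2] coeff_ev_edge(2)[OF g d(2)] unfolding d by simp
    qed
  next
    case False
    hence "mdeg (i, j, 0) \<noteq> d" by (simp add: mdeg_def)
    hence "(i, j, 0) \<notin> Poly_Mapping.keys g" using g unfolding homogeneous_of_def by blast
    thus ?thesis by (simp add: in_keys_iff)
  qed
  then obtain e h where h: "d = Suc e" "homogeneous_of e h" "g = h * X2"
    using homogeneous_divide_X2[OF g g0] by blast
  show ?thesis
  proof (rule that)
    show "d = Suc e" by fact
    show "homogeneous_of e (ev cst h (lin (cross q r)) (lin (cross r p)) (lin (cross p q)))"
      by (intro homogeneous_ev h homogeneous_lin)
    show "f = lin (cross p q) * ev cst h (lin (cross q r)) (lin (cross r p)) (lin (cross p q))"
      using inv unfolding h by (simp add: mult.commute)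
  qed
qed

text \<open>The last clause covers all points and multiplicities at once, so that an induction can
  follow several points through the same division.\<close>

lemma split_off_line:
  fixes f :: "'k::field poly3"
  assumes f: "homogeneous_of d f" "f \<noteq> 0" and ab: "vanishes p a f" "vanishes q b f" "d < a + b"
    and pq: "proj_point (cross p q)"
  obtains e g where "d = Suc e" "homogeneous_of e g" "g \<noteq> 0"
    "\<And>r m. vanishes r m f \<Longrightarrow> vanishes r (if on_line (cross p q) r then m - 1 else m) g"
proof -
  from line_dvd[OF assms] obtain e g where g: "d = Suc e" "homogeneous_of e g" "f = lin (cross p q) * g"
    by blast
  show ?thesis
    by (rule that[OF g(1,2)]) (use f(2) g(3) vanishes_lin_cancel[OF pq] in auto)
qed

lemma on_line_cross [simp]: "on_line (cross p q) p" "on_line (cross p q) q"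
  by (simp_all add: on_line_def cross_def algebra_simps)

text \<open>If \<open>m > d\<close>, any second point \<open>q\<close> with multiplicity 0 allows a
  line to be split off. Degree and multiplicity at \<open>p\<close> both drop by one, so the excess
  persists down to degree 0, where no line can be a factor.\<close>

lemma vanishes_le_degree:
  fixes f :: "'k::field poly3"
  assumes "homogeneous_of d f" "f \<noteq> 0" "vanishes p m f" "proj_point p"
  shows "m \<le> d"
proof -
  obtain q where q: "proj_point (cross p q)"
  proof -
    consider "c0 p \<noteq> 0" | "c1 p \<noteq> 0" | "c2 p \<noteq> 0"
      using assms(4) by (cases p) (auto simp: proj_point_def)
    thus ?thesis
      by cases (use that[of "(1, 0, 0)"] that[of "(0, 1, 0)"] in \<open>auto simp: cross_def proj_point_def\<close>)
  qed
  show ?thesis using assms(1-3)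
  proof (induction d arbitrary: f m rule: less_induct)
    case (less d f m)
    show ?case
    proof (rule ccontr)
      assume "\<not> m \<le> d"
      moreover have "vanishes q 0 f" by (simp add: vanishes_def)
      ultimately obtain e g where g: "d = Suc e" "homogeneous_of e g" "g \<noteq> 0"
        "\<And>r m. vanishes r m f \<Longrightarrow> vanishes r (if on_line (cross p q) r then m - 1 else m) g"
        using split_off_line[OF less.prems, of q 0] q by auto
      have "m - 1 \<le> e"
        using less.IH[of e g "m - 1"] g(1-3) g(4)[OF less.prems(3)] by simp
      thus False using \<open>\<not> m \<le> d\<close> g(1) by simp
    qed
  qed
qed

section \<open>Degree bounds\<close>

lemma proj_point_cross: "proj_point (cross p q) \<Longrightarrow> proj_point p" "proj_point (cross p q) \<Longrightarrow> proj_point q"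
  by (auto simp: proj_point_def cross_def)

text \<open>If \<open>d < a + m q\<close> for some \<open>q\<close>, splitting off the line through
  \<open>p\<close> and \<open>q\<close> lowers \<open>d\<close>, \<open>a\<close> and
  \<open>m q\<close> by one and no other multiplicity, so both sides drop by \<open>card S\<close>.
  Otherwise the inequalities \<open>a + m q \<le> d\<close> are summed over
  \<open>S\<close>.\<close>

theorem star_bound:
  fixes f :: "'k::field poly3" and m :: "'k pt3 \<Rightarrow> nat"
  assumes S: "finite S" "S \<noteq> {}"
    and lines: "\<And>q. q \<in> S \<Longrightarrow> proj_point (cross p q)"
      "\<And>q r. q \<in> S \<Longrightarrow> r \<in> S \<Longrightarrow> q \<noteq> r \<Longrightarrow> \<not> on_line (cross p q) r"
    and f: "homogeneous_of d f" "f \<noteq> 0" "vanishes p a f" "\<And>q. q \<in> S \<Longrightarrow> vanishes q (m q) f"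
  shows "(card S - 1) * a + sum m S \<le> card S * d"
  using f
proof (induction d arbitrary: f a m rule: less_induct)
  case (less d f a m)
  show ?case
  proof (cases "\<exists>q\<in>S. d < a + m q")
    case True
    then obtain q where q: "q \<in> S" "d < a + m q" by blast
    obtain e g where g: "d = Suc e" "homogeneous_of e g" "g \<noteq> 0"
      "\<And>r m. vanishes r m f \<Longrightarrow> vanishes r (if on_line (cross p q) r then m - 1 else m) g"
      using split_off_line[OF less.prems(1-3) less.prems(4)[OF q(1)] q(2) lines(1)[OF q(1)]] by metis
    \<comment> \<open>Together with \<open>d < a + m q\<close> this makes \<open>a\<close> and
      \<open>m q\<close> positive, so the truncated subtractions really lower them by one.\<close>
    have "a \<le> d" "m q \<le> d"
      using vanishes_le_degree[OF less.prems(1,2)] less.prems(3,4) q(1) proj_point_cross lines(1) by blast+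
    with q have pos: "a > 0" "m q > 0" by auto
    define m' where "m' = m(q := m q - 1)"
    have "vanishes r (m' r) g" if "r \<in> S" for r
      using g(4)[OF less.prems(4)[OF that]] lines(2)[OF q(1) that] by (auto simp: m'_def)
    moreover have "vanishes p (a - 1) g"
      using g(4)[OF less.prems(3)] by simp
    ultimately have IH: "(card S - 1) * (a - 1) + sum m' S \<le> card S * e"
      using less.IH[of e g "a - 1" m'] g by auto
    have s: "sum m S = Suc (sum m' S)"
      using q(1) S(1) pos by (simp add: sum.remove m'_def)
    obtain a' where a': "a = Suc a'" using pos by (cases a) auto
    obtain n where n: "card S = Suc n" using S by (cases "card S") auto
    show ?thesis using IH unfolding s a' n g(1) by simp
  next
    case False
    hence "(\<Sum>q\<in>S. a + m q) \<le> (\<Sum>q\<in>S. d)"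
      by (intro sum_mono) auto
    moreover have "(card S - 1) * a \<le> card S * a" by (intro mult_right_mono) simp_all
    moreover have "(\<Sum>q\<in>S. a + m q) = card S * a + sum m S" "(\<Sum>q\<in>S. d) = card S * d"
      by (simp_all add: sum.distrib)
    ultimately show ?thesis by linarith
  qed
qed

text \<open>The two opposite sides \<open>pq\<close> and \<open>rs\<close> cover the four points.
  Splitting off a side whose multiplicities exceed \<open>d\<close> lowers both sides of the bound
  by 2; if neither exceeds \<open>d\<close>, the two inequalities add up.\<close>

theorem quadrangle_bound:
  fixes f :: "'k::field poly3"
  assumes lines: "proj_point (cross p q)" "proj_point (cross r s)"
      "\<not> on_line (cross p q) r" "\<not> on_line (cross p q) s" "\<not> on_line (cross r s) p" "\<not> on_line (cross r s) q"
    and f: "homogeneous_of d f" "f \<noteq> 0" "vanishes p a f" "vanishes q b f" "vanishes r a' f" "vanishes s b' f"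
  shows "a + b + a' + b' \<le> 2 * d"
  using f
proof (induction d arbitrary: f a b a' b' rule: less_induct)
  case (less d f a b a' b')
  have le: "a \<le> d" "b \<le> d" "a' \<le> d" "b' \<le> d"
    using vanishes_le_degree[OF less.prems(1,2)] less.prems(3-6) proj_point_cross lines(1,2) by blast+
  consider "d < a + b" | "d < a' + b'" | "a + b \<le> d" "a' + b' \<le> d" by linarith
  thus ?case
  proof cases
    case 1
    obtain e g where g: "d = Suc e" "homogeneous_of e g" "g \<noteq> 0"
      "\<And>r m. vanishes r m f \<Longrightarrow> vanishes r (if on_line (cross p q) r then m - 1 else m) g"
      using split_off_line[OF less.prems(1-4) 1 lines(1)] by metis
    have "(a - 1) + (b - 1) + a' + b' \<le> 2 * e"
      using less.IH[of e g "a - 1" "b - 1" a' b'] g(1-3) lines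
        g(4)[OF less.prems(3)] g(4)[OF less.prems(4)] g(4)[OF less.prems(5)] g(4)[OF less.prems(6)]
      by simp
    thus ?thesis using g(1) le 1 by simp
  next
    case 2
    obtain e g where g: "d = Suc e" "homogeneous_of e g" "g \<noteq> 0"
      "\<And>t m. vanishes t m f \<Longrightarrow> vanishes t (if on_line (cross r s) t then m - 1 else m) g"
      using split_off_line[OF less.prems(1,2,5,6) 2 lines(2)] by metis
    have "a + b + (a' - 1) + (b' - 1) \<le> 2 * e"
      using less.IH[of e g a b "a' - 1" "b' - 1"] g(1-3) lines
        g(4)[OF less.prems(3)] g(4)[OF less.prems(4)] g(4)[OF less.prems(5)] g(4)[OF less.prems(6)]
      by simp
    thus ?thesis using g(1) le 2 by simp
  qed simp
qed

section \<open>Powers of ideals\<close>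

lemma ideal_gen_incl: "s \<in> S \<Longrightarrow> s \<in> ideal_gen S"
  unfolding ideal_gen_def by (auto intro!: exI[of _ "{s}"] exI[of _ "\<lambda>_. 1"])

lemma ideal_gen_mult: "f \<in> ideal_gen S \<Longrightarrow> h * f \<in> ideal_gen S"
  unfolding ideal_gen_def
proof safe
  fix F g assume F: "finite F" "F \<subseteq> S"
  have "h * (\<Sum>s\<in>F. g s * s) = (\<Sum>s\<in>F. (h * g s) * s)"
    by (simp add: sum_distrib_left mult.assoc)
  thus "\<exists>F' g'. finite F' \<and> F' \<subseteq> S \<and> h * (\<Sum>s\<in>F. g s * s) = (\<Sum>s\<in>F'. g' s * s)"
    using F by (intro exI[of _ F] exI[of _ "\<lambda>s. h * g s"]) simp
qed

lemma ideal_gen_add: "f \<in> ideal_gen S \<Longrightarrow> f' \<in> ideal_gen S \<Longrightarrow> f + f' \<in> ideal_gen S"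
proof -
  assume "f \<in> ideal_gen S" "f' \<in> ideal_gen S"
  then obtain F g F' g' where F: "finite F" "F \<subseteq> S" "f = (\<Sum>s\<in>F. g s * s)"
    "finite F'" "F' \<subseteq> S" "f' = (\<Sum>s\<in>F'. g' s * s)"
    unfolding ideal_gen_def by blast
  define G where "G s = (if s \<in> F then g s else 0) + (if s \<in> F' then g' s else 0)" for s
  have "f = (\<Sum>s\<in>F \<union> F'. (if s \<in> F then g s else 0) * s)"
    unfolding F using F by (intro sum.mono_neutral_cong_left) auto
  moreover have "f' = (\<Sum>s\<in>F \<union> F'. (if s \<in> F' then g' s else 0) * s)"
    unfolding F using F by (intro sum.mono_neutral_cong_left) auto
  ultimately have "f + f' = (\<Sum>s\<in>F \<union> F'. G s * s)"
    by (simp add: G_def distrib_right sum.distrib)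
  thus ?thesis unfolding ideal_gen_def using F by blast
qed

lemma ideal_gen_sum:
  assumes "\<And>x. x \<in> A \<Longrightarrow> f x \<in> ideal_gen S" shows "sum f A \<in> ideal_gen S"
proof -
  have "0 \<in> ideal_gen S" unfolding ideal_gen_def by (auto intro!: exI[of _ "{}"])
  thus ?thesis using assms by (induction A rule: infinite_finite_induct) (auto intro: ideal_gen_add)
qed

lemma ideal_pow_lmult: "f \<in> ideal_pow I n \<Longrightarrow> h * f \<in> ideal_pow I n"
  unfolding ideal_pow_def by (rule ideal_gen_mult)

lemma ideal_pow_mult:
  assumes "f \<in> ideal_pow I a" "g \<in> ideal_pow I b"
  shows "f * g \<in> ideal_pow I (a + b)"
proof -
  define Q where "Q n = {prod_list xs | xs. length xs = n \<and> set xs \<subseteq> I}" for n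
  have Q: "s * t \<in> Q (a + b)" if s: "s \<in> Q a" and t: "t \<in> Q b" for s t
  proof -
    from s obtain xs where "s = prod_list xs" "length xs = a" "set xs \<subseteq> I" unfolding Q_def by blast
    moreover from t obtain ys where "t = prod_list ys" "length ys = b" "set ys \<subseteq> I" unfolding Q_def by blast
    ultimately show ?thesis unfolding Q_def by (intro CollectI exI[of _ "xs @ ys"]) auto
  qed
  from assms obtain F u G v where
    F: "F \<subseteq> Q a" "f = (\<Sum>s\<in>F. u s * s)" and G: "G \<subseteq> Q b" "g = (\<Sum>t\<in>G. v t * t)"
    unfolding ideal_pow_def ideal_gen_def Q_def by blast
  have "f * g = (\<Sum>s\<in>F. \<Sum>t\<in>G. (u s * v t) * (s * t))"
    unfolding F G sum_product by (simp add: mult_ac)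
  also have "\<dots> \<in> ideal_gen (Q (a + b))"
    using F(1) G(1) by (intro ideal_gen_sum ideal_gen_mult ideal_gen_incl Q) auto
  finally show ?thesis unfolding ideal_pow_def Q_def .
qed

lemma ideal_pow_power: "f \<in> I \<Longrightarrow> f ^ n \<in> ideal_pow I n"
  unfolding ideal_pow_def
  by (intro ideal_gen_incl CollectI exI[of _ "replicate n f"]) (auto simp: prod_list_replicate dest: in_set_replicate[THEN iffD1])

text \<open>The slack \<open>m \<le> n\<close> lets one power of a line serve points of different
  multiplicities.\<close>

lemma lin_power_in_ideal_pow:
  assumes "on_line l p" "m \<le> n" shows "lin l ^ n \<in> ideal_pow (point_ideal p) m"
proof -
  have "ev (\<lambda>x. x) (lin l) (c0 p) (c1 p) (c2 p) = 0"
  proof -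
    interpret i: comm_ring_hom "\<lambda>x :: 'a. x" by unfold_locales (rule refl)+
    show ?thesis using assms(1) unfolding i.ev_lin by (simp only: on_line_def)
  qed
  hence "lin l \<in> point_ideal p"
    unfolding point_ideal_def using homogeneous_lin[of l]
    by (intro ideal_gen_incl CollectI exI[of _ 1]) (simp only: eval3_eq_ev simp_thms)
  hence "lin l ^ (n - m) * lin l ^ m \<in> ideal_pow (point_ideal p) m"
    by (intro ideal_pow_lmult ideal_pow_power)
  thus ?thesis using assms(2) by (simp flip: power_add)
qed

lemma ideal_gen_dvd_nbhd:
  assumes "f \<in> ideal_gen S" "\<And>s. s \<in> S \<Longrightarrow> t dvd nbhd p s" shows "t dvd nbhd p f"
proof -
  from assms(1) obtain F g where F: "F \<subseteq> S" "f = (\<Sum>s\<in>F. g s * s)"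
    unfolding ideal_gen_def by blast
  show ?thesis unfolding F(2) nbhd.hom_sum nbhd.hom_mult
    using F(1) assms(2) by (intro dvd_sum dvd_mult) blast
qed

lemma point_ideal_vanishes:
  fixes p :: "'k::field pt3"
  assumes "f \<in> point_ideal p" shows "T dvd nbhd p f"
  using assms unfolding point_ideal_def
proof (rule ideal_gen_dvd_nbhd)
  fix g :: "'k poly3" assume "g \<in> {f. \<exists>d. homogeneous_of d f \<and> eval3 f p = 0}"
  hence "const4 (ev (\<lambda>x. x) g (c0 p) (c1 p) (c2 p)) = 0"
    by (simp add: eval3_eq_ev)
  hence "ev const4 g (const4 (c0 p)) (const4 (c1 p)) (const4 (c2 p)) = 0"
    by (subst (asm) const4.ev_hom)
  moreover have "T dvd nbhd p g - ev const4 g (const4 (c0 p)) (const4 (c1 p)) (const4 (c2 p))"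
    unfolding nbhd_def by (rule const4.ev_dvd_diff) (simp_all only: add_diff_cancel_left' dvd_triv_left)
  ultimately show "T dvd nbhd p g" by simp
qed

text \<open>Each of the \<open>m\<close> factors of a generator contributes one \<open>T\<close>.
  This carries degree bounds for forms with given multiplicities over to the symbolic
  powers.\<close>

lemma ideal_pow_vanishes:
  fixes p :: "'k::field pt3"
  assumes "f \<in> ideal_pow (point_ideal p) m" shows "vanishes p m f"
  using assms unfolding ideal_pow_def vanishes_def
proof (rule ideal_gen_dvd_nbhd)
  fix g :: "'k poly3" assume "g \<in> {prod_list xs |xs. length xs = m \<and> set xs \<subseteq> point_ideal p}"
  then obtain xs where xs: "g = prod_list xs" "length xs = m" "set xs \<subseteq> point_ideal p" by blast
  from xs(3) have "T ^ length xs dvd nbhd p (prod_list xs)"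
    by (induction xs) (auto intro!: mult_dvd_mono point_ideal_vanishes)
  thus "T ^ m dvd nbhd p g" by (simp add: xs)
qed

section \<open>Waldschmidt constants\<close>

text \<open>Fekete's lemma: the limit is the infimum of the ratios. Take \<open>k\<close> with ratio
  close to it and write \<open>n = q k + n mod k\<close>; the remainder contributes at most a
  constant \<open>C\<close>, negligible after division by \<open>n\<close>.\<close>

lemma fekete_limit:
  fixes a :: "nat \<Rightarrow> real"
  assumes nonneg: "\<And>n. a n \<ge> 0" and sub: "\<And>m n. a (m + n) \<le> a m + a n"
  obtains L where "(\<lambda>n. a n / real n) \<longlonglongrightarrow> L" "\<And>n. n \<ge> 1 \<Longrightarrow> L \<le> a n / real n"
proof
  define L where "L = (INF n\<in>{1..}. a n / real n)"
  have bdd: "bdd_below ((\<lambda>n. a n / real n) ` {1..})"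
    by (rule bdd_belowI[of _ 0]) (auto intro!: divide_nonneg_nonneg nonneg)
  show L: "L \<le> a n / real n" if "n \<ge> 1" for n
    unfolding L_def using that by (intro cINF_lower bdd) auto
  \<comment> \<open>For \<open>q = 0\<close> this would say \<open>a 0 \<le> 0\<close>, which does
    not follow from the hypotheses.\<close>
  have mult: "a (q * k) \<le> real q * a k" if "q \<ge> 1" for q k
    using that
  proof (induction q rule: dec_induct)
    case (step q)
    show ?case using sub[of k "q * k"] step by (simp add: algebra_simps)
  qed simp
  show "(\<lambda>n. a n / real n) \<longlonglongrightarrow> L"
  proof (rule LIMSEQ_I)
    fix r :: real assume r: "r > 0"
    have "\<exists>k\<in>{1..}. a k / real k < L + r / 2"
      using cINF_less_iff[OF _ bdd, of "L + r / 2"] r by (auto simp: L_def)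
    then obtain k where k: "k \<ge> 1" "a k / real k < L + r / 2" by auto
    define C where "C = (\<Sum>i<k. a i)"
    have C: "a i \<le> C" if "i < k" for i
      unfolding C_def using that nonneg by (intro member_le_sum) auto
    obtain N :: nat where N: "2 * C / r < real N" using reals_Archimedean2 by blast
    have "norm (a n / real n - L) < r" if n: "n \<ge> max 1 (max k (Suc N))" for n
    proof -
      have n1: "n \<ge> 1" "n \<ge> k" "n > N" using n by auto
      define q where "q = n div k"
      have q: "q \<ge> 1" using n1 k(1) by (simp add: q_def div_greater_zero_iff Suc_leI)
      have "a n \<le> a (q * k) + a (n mod k)"
        using sub[of "q * k" "n mod k"] by (simp add: q_def)
      also have "\<dots> \<le> real q * a k + C"
        using mult[OF q, of k] C[of "n mod k"] k(1) by simp
      also have "real q * a k = real (q * k) * (a k / real k)"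
        using k(1) by simp
      also have "\<dots> \<le> real n * (a k / real k)"
        proof (rule mult_right_mono)
        have "q * k \<le> n" by (simp add: q_def)
        thus "real (q * k) \<le> real n" by (simp only: of_nat_le_iff)
      qed (use nonneg[of k] in simp)
      finally have "a n \<le> real n * (a k / real k) + C" by simp
      hence "a n / real n \<le> a k / real k + C / real n"
        using n1(1) by (simp add: field_simps)
      moreover have "C / real n < r / 2"
      proof -
        have "2 * C / r < real n" using N n1 by linarith
        thus ?thesis using r n1(1) by (simp add: field_simps)
      qed
      ultimately have "a n / real n < L + r" using k(2) by linarith
      thus ?thesis using L[OF n1(1)] by simp
    qed
    thus "\<exists>no. \<forall>n\<ge>no. norm (a n / real n - L) < r" by blast
  qed
qed

lemma exists_line_through:
  fixes p :: "'k::field pt3" obtains l where "proj_point l" "on_line l p"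
proof (cases "c0 p = 0 \<and> c1 p = 0")
  case True
  thus ?thesis by (intro that[of "(1, 0, 0)"]) (auto simp: proj_point_def on_line_def)
next
  case False
  thus ?thesis by (intro that[of "(c1 p, - c0 p, 0)"]) (auto simp: proj_point_def on_line_def)
qed

lemma alpha_le: "f \<in> J \<Longrightarrow> f \<noteq> 0 \<Longrightarrow> homogeneous_of d f \<Longrightarrow> alpha J \<le> d"
  unfolding alpha_def by (rule Least_le) blast

section \<open>Symbolic powers of the ideal of a fat point scheme\<close>

locale fat_points =
  fixes P :: "'k::field pt3 set" and mult :: "'k pt3 \<Rightarrow> nat"
  assumes finP: "finite P"
begin

lemma in_fat_ideal_vanishes: "f \<in> fat_ideal_sym P mult k \<Longrightarrow> p \<in> P \<Longrightarrow> vanishes p (k * mult p) f"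
  unfolding fat_ideal_sym_def by (auto intro: ideal_pow_vanishes)

text \<open>The \<open>LEAST\<close> in \<open>alpha\<close> is meaningful only if some nonzero form
  exists: take a line through each point, raise it to the required multiplicity, and
  multiply.\<close>

lemma alpha_attained:
  obtains f where "f \<in> fat_ideal_sym P mult k" "f \<noteq> 0" "homogeneous_of (alpha (fat_ideal_sym P mult k)) f"
proof -
  have "\<exists>l. proj_point l \<and> on_line l p" for p :: "'k pt3" using exists_line_through by blast
  then obtain l where l: "\<And>p :: 'k pt3. proj_point (l p)" "\<And>p. on_line (l p) p" by metis
  define f where "f = (\<Prod>p\<in>P. lin (l p) ^ (k * mult p))"
  have "f \<in> ideal_pow (point_ideal p) (k * mult p)" if "p \<in> P" for p
  proof -
    have "f = (\<Prod>p\<in>P - {p}. lin (l p) ^ (k * mult p)) * lin (l p) ^ (k * mult p)"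
      unfolding f_def using finP that by (simp add: prod.remove mult.commute)
    thus ?thesis by (simp only:) (intro ideal_pow_lmult lin_power_in_ideal_pow l order_refl)
  qed
  hence "f \<in> fat_ideal_sym P mult k" by (simp add: fat_ideal_sym_def)
  moreover have "f \<noteq> 0"
    unfolding f_def using poly3_prod_eq_0[OF finP] poly3_power_eq_0 lin_nonzero[OF l(1)] by blast
  moreover have "homogeneous_of (\<Sum>p\<in>P. k * mult p * 1) f"
    unfolding f_def by (intro homogeneous_prod homogeneous_power homogeneous_lin)
  ultimately have "\<exists>d. \<exists>f\<in>fat_ideal_sym P mult k. f \<noteq> 0 \<and> homogeneous_of d f" by blast
  from LeastI_ex[OF this] show ?thesis using that unfolding alpha_def by blast
qed

lemma alpha_subadditive:
  "alpha (fat_ideal_sym P mult (m + n)) \<le> alpha (fat_ideal_sym P mult m) + alpha (fat_ideal_sym P mult n)"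
proof -
  obtain f where f: "f \<in> fat_ideal_sym P mult m" "f \<noteq> 0" "homogeneous_of (alpha (fat_ideal_sym P mult m)) f"
    by (rule alpha_attained)
  obtain g where g: "g \<in> fat_ideal_sym P mult n" "g \<noteq> 0" "homogeneous_of (alpha (fat_ideal_sym P mult n)) g"
    by (rule alpha_attained)
  have "f * g \<in> fat_ideal_sym P mult (m + n)"
    using f(1) g(1) by (auto simp: fat_ideal_sym_def distrib_right intro: ideal_pow_mult)
  moreover have "f * g \<noteq> 0" using f(2) g(2) poly3_mult_eq_0 by blast
  ultimately show ?thesis by (rule alpha_le) (intro homogeneous_mult f g)
qed

text \<open>Convergence comes from subadditivity of \<open>alpha\<close>. As the limit is also the
  infimum, a single form in a single symbolic power already gives an upper bound.\<close>

lemma waldschmidt_limit: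
  "(\<lambda>k. real (alpha (fat_ideal_sym P mult k)) / real k) \<longlonglongrightarrow> waldschmidt P mult"
  "n \<ge> 1 \<Longrightarrow> waldschmidt P mult \<le> real (alpha (fat_ideal_sym P mult n)) / real n"
proof -
  obtain L where L: "(\<lambda>k. real (alpha (fat_ideal_sym P mult k)) / real k) \<longlonglongrightarrow> L"
    "\<And>n. n \<ge> 1 \<Longrightarrow> L \<le> real (alpha (fat_ideal_sym P mult n)) / real n"
  proof (rule fekete_limit)
    show "real (alpha (fat_ideal_sym P mult (m + n)))
        \<le> real (alpha (fat_ideal_sym P mult m)) + real (alpha (fat_ideal_sym P mult n))" for m n
      using alpha_subadditive[of m n] by linarith
  qed auto
  have "waldschmidt P mult = L"
    unfolding waldschmidt_def using L(1) by (rule limI)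
  thus "(\<lambda>k. real (alpha (fat_ideal_sym P mult k)) / real k) \<longlonglongrightarrow> waldschmidt P mult"
    "n \<ge> 1 \<Longrightarrow> waldschmidt P mult \<le> real (alpha (fat_ideal_sym P mult n)) / real n"
    using L by auto
qed

lemma waldschmidt_le:
  assumes "k \<ge> 1" "f \<noteq> 0" "homogeneous_of d f" "\<And>p. p \<in> P \<Longrightarrow> f \<in> ideal_pow (point_ideal p) (k * mult p)"
  shows "waldschmidt P mult \<le> real d / real k"
proof -
  have "alpha (fat_ideal_sym P mult k) \<le> d"
    using assms by (intro alpha_le[of f]) (auto simp: fat_ideal_sym_def)
  hence "real (alpha (fat_ideal_sym P mult k)) / real k \<le> real d / real k"
    by (intro divide_right_mono) auto
  thus ?thesis using waldschmidt_limit(2)[OF assms(1)] by linarith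
qed

text \<open>A degree bound that is linear and uniform in \<open>k\<close> passes to the limit; the
  fraction is kept as two naturals so that degree bounds can be used as they stand.\<close>

lemma waldschmidt_ge:
  assumes "\<And>k d f. f \<noteq> 0 \<Longrightarrow> homogeneous_of d f \<Longrightarrow> (\<And>p. p \<in> P \<Longrightarrow> vanishes p (k * mult p) f) \<Longrightarrow>
      a * k \<le> b * d" and "b > 0"
  shows "real a / real b \<le> waldschmidt P mult"
proof (rule LIMSEQ_le_const[OF waldschmidt_limit(1)], intro exI allI impI)
  fix k :: nat assume k: "1 \<le> k"
  obtain f where f: "f \<in> fat_ideal_sym P mult k" "f \<noteq> 0" "homogeneous_of (alpha (fat_ideal_sym P mult k)) f"
    by (rule alpha_attained)
  have "a * k \<le> b * alpha (fat_ideal_sym P mult k)"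
    using assms(1)[OF f(2,3)] in_fat_ideal_vanishes[OF f(1)] by blast
  hence "real a * real k \<le> real b * real (alpha (fat_ideal_sym P mult k))"
    by (metis of_nat_le_iff of_nat_mult)
  thus "real a / real b \<le> real (alpha (fat_ideal_sym P mult k)) / real k"
    using k assms(2) by (simp add: field_simps)
qed

lemma waldschmidt_ge_mult:
  assumes "p \<in> P" "proj_point p" shows "real (mult p) \<le> waldschmidt P mult"
proof -
  have "real (mult p) / real 1 \<le> waldschmidt P mult"
  proof (rule waldschmidt_ge)
    fix k d and f :: "'k poly3"
    assume f: "f \<noteq> 0" "homogeneous_of d f" "\<And>p. p \<in> P \<Longrightarrow> vanishes p (k * mult p) f"
    thus "mult p * k \<le> 1 * d"
      using vanishes_le_degree[OF f(2,1) f(3)[OF assms(1)] assms(2)] by (simp add: mult.commute)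
  qed simp
  thus ?thesis by simp
qed

lemma waldschmidt_ge_star:
  assumes "p \<in> P" "S \<subseteq> P" "S \<noteq> {}" "\<And>q. q \<in> S \<Longrightarrow> proj_point (cross p q)"
      "\<And>q r. q \<in> S \<Longrightarrow> r \<in> S \<Longrightarrow> q \<noteq> r \<Longrightarrow> \<not> on_line (cross p q) r"
  shows "real ((card S - 1) * mult p + sum mult S) / real (card S) \<le> waldschmidt P mult"
proof (rule waldschmidt_ge)
  have S: "finite S" using assms(2) finP finite_subset by blast
  thus "card S > 0" using assms(3) by (simp add: card_gt_0_iff)
  fix k d and f :: "'k poly3"
  assume f: "f \<noteq> 0" "homogeneous_of d f" "\<And>p. p \<in> P \<Longrightarrow> vanishes p (k * mult p) f"
  have "(card S - 1) * (k * mult p) + (\<Sum>q\<in>S. k * mult q) \<le> card S * d"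
    using assms f by (intro star_bound[of S p d f] S) auto
  thus "((card S - 1) * mult p + sum mult S) * k \<le> card S * d"
    by (simp add: algebra_simps sum_distrib_left)
qed

lemma waldschmidt_ge_quadrangle:
  assumes "{p, q, r, s} \<subseteq> P" "proj_point (cross p q)" "proj_point (cross r s)"
      "\<not> on_line (cross p q) r" "\<not> on_line (cross p q) s" "\<not> on_line (cross r s) p" "\<not> on_line (cross r s) q"
  shows "real (mult p + mult q + mult r + mult s) / 2 \<le> waldschmidt P mult"
proof -
  have "real (mult p + mult q + mult r + mult s) / real 2 \<le> waldschmidt P mult"
  proof (rule waldschmidt_ge)
    fix k d and f :: "'k poly3"
    assume f: "f \<noteq> 0" "homogeneous_of d f" "\<And>p. p \<in> P \<Longrightarrow> vanishes p (k * mult p) f"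
    have "k * mult p + k * mult q + k * mult r + k * mult s \<le> 2 * d"
      using assms f by (intro quadrangle_bound[of p q r s d f]) auto
    thus "(mult p + mult q + mult r + mult s) * k \<le> 2 * d"
      by (simp add: algebra_simps)
  qed simp
  thus ?thesis by simp
qed

end

section \<open>Incidences\<close>

text \<open>The entries of the cross product are the 2 by 2 minors, so their vanishing means
  proportionality; a nonzero coordinate of \<open>p\<close> yields the factor.\<close>

lemma proj_eqI_cross:
  fixes p q :: "'k::field pt3"
  assumes "proj_point p" "proj_point q" "\<not> proj_point (cross p q)"
  shows "proj_eq p q"
proof -
  obtain a b c where p: "p = (a, b, c)" by (cases p)
  obtain x y z where q: "q = (x, y, z)" by (cases q)
  have e: "b * z = c * y" "c * x = a * z" "a * y = b * x"
    using assms(3) by (simp_all add: p q cross_def proj_point_def)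
  consider "a \<noteq> 0" | "b \<noteq> 0" | "c \<noteq> 0"
    using assms(1) by (auto simp: p proj_point_def)
  thus ?thesis
  proof cases
    case 1
    hence "y = x / a * b" "z = x / a * c" using e by (simp_all add: field_simps)
    moreover have "x \<noteq> 0" using calculation assms(2) by (auto simp: q proj_point_def)
    ultimately show ?thesis unfolding proj_eq_def using 1 by (intro exI[of _ "x / a"]) (simp add: p q)
  next
    case 2
    hence "x = y / b * a" "z = y / b * c" using e by (simp_all add: field_simps)
    moreover have "y \<noteq> 0" using calculation assms(2) by (auto simp: q proj_point_def)
    ultimately show ?thesis unfolding proj_eq_def using 2 by (intro exI[of _ "y / b"]) (simp add: p q)
  next
    case 3
    hence "x = z / c * a" "y = z / c * b" using e by (simp_all add: field_simps)
    moreover have "z \<noteq> 0" using calculation assms(2) by (auto simp: q proj_point_def)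
    ultimately show ?thesis unfolding proj_eq_def using 3 by (intro exI[of _ "z / c"]) (simp add: p q)
  qed
qed

lemma proj_eq_on_line:
  assumes "proj_eq l l'" shows "on_line l p \<longleftrightarrow> on_line l' p"
proof -
  obtain c where c: "c \<noteq> 0" "l' = (c * c0 l, c * c1 l, c * c2 l)"
    using assms by (auto simp: proj_eq_def)
  have "c0 l' * c0 p + c1 l' * c1 p + c2 l' * c2 p = c * (c0 l * c0 p + c1 l * c1 p + c2 l * c2 p)"
    by (simp add: c(2) algebra_simps)
  thus ?thesis using c(1) by (simp add: on_line_def)
qed

text \<open>Expanding the triple product, \<open>cross l (cross p q)\<close> equals
  \<open>(l . q) p - (l . p) q\<close>, which is zero here; so \<open>l\<close> is proportional to
  \<open>cross p q\<close>.\<close>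

lemma on_line_iff_cross:
  fixes l p q :: "'k::field pt3"
  assumes l: "proj_point l" "on_line l p" "on_line l q" and pq: "proj_point (cross p q)"
  shows "on_line l r \<longleftrightarrow> on_line (cross p q) r"
proof -
  let ?e = "\<lambda>r. c0 l * c0 r + c1 l * c1 r + c2 l * c2 r"
  have "cross l (cross p q) = (c0 p * ?e q - c0 q * ?e p, c1 p * ?e q - c1 q * ?e p, c2 p * ?e q - c2 q * ?e p)"
    by (simp add: cross_def algebra_simps)
  hence "\<not> proj_point (cross l (cross p q))"
    using l(2,3) by (simp add: on_line_def proj_point_def)
  thus ?thesis using proj_eqI_cross[OF l(1) pq] proj_eq_on_line by blast
qed

text \<open>Both sides say that the determinant of \<open>p\<close>, \<open>q\<close>,
  \<open>r\<close> vanishes, and it is invariant under cyclic permutation.\<close>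

lemma on_line_cross_rotate: "on_line (cross p q) r \<longleftrightarrow> on_line (cross q r) p"
  by (simp add: on_line_def cross_def algebra_simps)

lemma on_line_cross_exchange:
  fixes p q r :: "'k::field pt3" shows "on_line (cross p q) r \<longleftrightarrow> on_line (cross p r) q"
proof -
  have "c0 (cross p q) * c0 r + c1 (cross p q) * c1 r + c2 (cross p q) * c2 r =
      - (c0 (cross p r) * c0 q + c1 (cross p r) * c1 q + c2 (cross p r) * c2 q)"
    by (simp add: cross_def algebra_simps)
  thus ?thesis unfolding on_line_def by (simp only: neg_equal_0_iff_equal)
qed

section \<open>Classification\<close>

text \<open>The negated forms (a), (b), (c) are assumed in the shape in which they produce new
  points: off a given line, off two given lines through \<open>p0\<close>, and outside a given set
  of four points.\<close>

lemma (in fat_points) waldschmidt_ge_five_halves: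
  assumes pts: "\<And>p. p \<in> P \<Longrightarrow> proj_point p"
    and dist: "\<And>p q. p \<in> P \<Longrightarrow> q \<in> P \<Longrightarrow> p \<noteq> q \<Longrightarrow> \<not> proj_eq p q"
    and pos: "\<And>p. p \<in> P \<Longrightarrow> mult p \<ge> 1"
    and p0: "p0 \<in> P" "mult p0 \<ge> 2"
    and notA: "\<And>l. \<forall>p\<in>P. mult p \<le> 2 \<Longrightarrow> proj_point l \<Longrightarrow> \<exists>p\<in>P. \<not> on_line l p"
    and notB: "\<And>L1 L2 p1 p2. mult p0 = 2 \<Longrightarrow> \<forall>p\<in>P - {p0}. mult p = 1 \<Longrightarrow> proj_point L1 \<Longrightarrow> proj_point L2 \<Longrightarrow>
      \<not> proj_eq L1 L2 \<Longrightarrow> on_line L1 p0 \<Longrightarrow> on_line L2 p0 \<Longrightarrow> p1 \<in> P - {p0} \<Longrightarrow> on_line L1 p1 \<Longrightarrow>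
      p2 \<in> P - {p0} \<Longrightarrow> on_line L2 p2 \<Longrightarrow> \<exists>p\<in>P - {p0}. \<not> on_line L1 p \<and> \<not> on_line L2 p"
    and notC: "\<And>p1 p2 p3 l. mult p0 = 2 \<Longrightarrow> \<forall>p\<in>P - {p0}. mult p = 1 \<Longrightarrow> card {p0, p1, p2, p3} = 4 \<Longrightarrow>
      proj_point l \<Longrightarrow> on_line l p1 \<Longrightarrow> on_line l p2 \<Longrightarrow> on_line l p3 \<Longrightarrow> \<not> on_line l p0 \<Longrightarrow> P \<noteq> {p0, p1, p2, p3}"
  shows "5 / 2 \<le> waldschmidt P mult"
proof (cases "\<forall>p\<in>P. mult p \<le> 2")
  case False
  then obtain p where p: "p \<in> P" "mult p \<ge> 3" by force
  have "real (mult p) \<le> waldschmidt P mult" using waldschmidt_ge_mult p(1) pts by blast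
  thus ?thesis using p(2) by linarith
next
  case le2: True
  have cross: "proj_point (cross p q)" if "p \<in> P" "q \<in> P" "p \<noteq> q" for p q
    using proj_eqI_cross pts dist that by blast
  have ne: "p \<noteq> r" "q \<noteq> r" if "\<not> on_line (cross p q) r" for p q r :: "'k pt3"
    using that by auto
  note notA = notA[OF le2]
  have m0: "mult p0 = 2" using le2 p0 by (simp add: le_antisym)
  show ?thesis
  proof (cases "\<exists>q\<in>P - {p0}. mult q = 2")
    case True
    then obtain q where q: "q \<in> P" "q \<noteq> p0" "mult q = 2" by blast
    obtain r where r: "r \<in> P" "\<not> on_line (cross p0 q) r"
      using notA[OF cross[OF p0(1) q(1)]] q(2) by blast
    note rne = ne[OF r(2)]
    \<comment> \<open>Star bound with centre \<open>p0\<close> and two lines: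
      \<open>(2 + 2 + mult r) / 2\<close> is at least \<open>5/2\<close>.\<close>
    have "real ((card {q, r} - 1) * mult p0 + sum mult {q, r}) / real (card {q, r}) \<le> waldschmidt P mult"
    proof (rule waldschmidt_ge_star)
      show "\<not> on_line (cross p0 x) y" if "x \<in> {q, r}" "y \<in> {q, r}" "x \<noteq> y" for x y
        using that r(2) on_line_cross_exchange[of p0 q r] by blast
    next
      show "proj_point (cross p0 x)" if "x \<in> {q, r}" for x
        using that cross p0(1) q(1,2) r(1) rne by blast
    qed (use p0 q r in auto)
    moreover have "mult r \<ge> 1" using pos r by blast
    ultimately show ?thesis using rne q(3) m0 by (simp add: field_simps)
  next
    case False
    have m1: "mult p = 1" if "p \<in> P" "p \<noteq> p0" for p
    proof -
      have "mult p \<le> 2" "1 \<le> mult p" "mult p \<noteq> 2" using le2 pos False that by auto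
      thus ?thesis by linarith
    qed
    \<comment> \<open>Four points of \<open>P\<close> including \<open>p0\<close>, no three
      collinear, give \<open>(2 + 1 + 1 + 1) / 2 = 5/2\<close> by the quadrangle bound.\<close>
    have quad: ?thesis if "x \<in> P" "y \<in> P" "z \<in> P" "x \<noteq> p0" "\<not> on_line (cross p0 x) y" "\<not> on_line (cross p0 x) z"
      "\<not> on_line (cross p0 y) z" "\<not> on_line (cross x y) z" for x y z
    proof -
      have n: "y \<noteq> p0" "z \<noteq> p0" "y \<noteq> z" using that ne by blast+
      have "real (mult p0 + mult x + mult y + mult z) / 2 \<le> waldschmidt P mult"
        using that p0 n cross on_line_cross_rotate by (intro waldschmidt_ge_quadrangle) blast+
      thus ?thesis using m0 m1 that n by simp
    qed
    \<comment> \<open>Some point of \<open>P\<close> is off this arbitrary line through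
      \<open>p0\<close>, and hence differs from \<open>p0\<close>.\<close>
    obtain l where l: "proj_point l" "on_line l p0" by (rule exists_line_through)
    obtain p1 where p1: "p1 \<in> P" "p1 \<noteq> p0" using notA[OF l(1)] l(2) by blast
    obtain p2 where p2: "p2 \<in> P" "\<not> on_line (cross p0 p1) p2"
      using notA[OF cross[OF p0(1) p1(1)]] p1 by blast
    note n12 = ne[OF p2(2)]
    have "\<not> proj_eq (cross p0 p1) (cross p0 p2)"
      using p2(2) proj_eq_on_line on_line_cross(2) by blast
    \<comment> \<open>Since form (b) is excluded, a third line through \<open>p0\<close> is
      occupied.\<close>
    then obtain p3 where p3: "p3 \<in> P" "\<not> on_line (cross p0 p1) p3" "\<not> on_line (cross p0 p2) p3"
      using notB[OF m0 _ cross[OF p0(1) p1(1)] cross[OF p0(1) p2(1)], of p1 p2] p1 p2 n12 m1 by auto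
    note n3 = ne[OF p3(2)] ne[OF p3(3)]
    show ?thesis
    proof (cases "on_line (cross p1 p2) p3")
      case False
      thus ?thesis using quad[of p1 p2 p3] p1 p2 p3 by blast
    next
      case col: True
      have "\<not> on_line (cross p1 p2) p0" using p2(2) on_line_cross_rotate by blast
      hence "P \<noteq> {p0, p1, p2, p3}"
        using notC[OF m0, of p1 p2 p3 "cross p1 p2"] m1 n12 n3 p1 cross[OF p1(1) p2(1)] col by auto
      then obtain p4 where p4: "p4 \<in> P" "p4 \<notin> {p0, p1, p2, p3}" using p0 p1 p2 p3 by blast
      \<comment> \<open>If \<open>p4\<close> lies on the line joining \<open>p0\<close> to one point
        \<open>x\<close> of the collinear triple, then \<open>p4\<close> replaces \<open>x\<close>:
        it is off the line of the triple, and \<open>quad\<close> applies to \<open>p4\<close>,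
        \<open>y\<close>, \<open>z\<close>.\<close>
      have meet: ?thesis if "x \<in> P" "y \<in> P" "z \<in> P" "x \<noteq> p0" "p4 \<noteq> x" "on_line (cross p0 x) p4"
          "\<not> on_line (cross p0 x) y" "\<not> on_line (cross p0 x) z" "\<not> on_line (cross p0 y) z" "on_line (cross y z) x"
        for x y z
      proof -
        have n: "y \<noteq> z" "p4 \<noteq> p0" using ne[OF that(9)] p4 by auto
        have pp: "proj_point (cross p0 x)" "proj_point (cross p0 p4)" "proj_point (cross y z)" "proj_point (cross x p4)"
          using cross[of p0 x] cross[of p0 p4] cross[of y z] cross[of x p4] p0(1) p4(1) that(1-5) n by auto
        have "on_line (cross p0 x) r \<longleftrightarrow> on_line (cross p0 p4) r" for r
          by (rule on_line_iff_cross[OF pp(1) on_line_cross(1) that(6) pp(2)])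
        hence "\<not> on_line (cross p0 p4) y" "\<not> on_line (cross p0 p4) z" using that by auto
        moreover have "\<not> on_line (cross p4 y) z"
        proof
          assume "on_line (cross p4 y) z"
          hence "on_line (cross y z) p4" by (subst (asm) on_line_cross_rotate)
          \<comment> \<open>Both lines would pass through \<open>x\<close> and \<open>p4\<close> and
            so coincide, but one contains \<open>p0\<close> and the other does not.\<close>
          hence "on_line (cross y z) p0 \<longleftrightarrow> on_line (cross x p4) p0"
            by (rule on_line_iff_cross[OF pp(3) that(10) _ pp(4)])
          moreover have "on_line (cross x p4) p0" using that(6) by (subst (asm) on_line_cross_rotate)
          moreover have "\<not> on_line (cross y z) p0" using that(9) by (subst (asm) on_line_cross_rotate)
          ultimately show False by blast
        qed
        ultimately show ?thesis using quad[of p4 y z] that p4 n by blast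
      qed
      have sym: "\<not> on_line (cross p0 p2) p1" "\<not> on_line (cross p0 p3) p1" "\<not> on_line (cross p0 p3) p2"
        "on_line (cross p2 p3) p1" "on_line (cross p1 p3) p2" "on_line (cross p1 p2) p3"
        using p2(2) p3(2,3) col on_line_cross_exchange[of p0 p1 p2] on_line_cross_exchange[of p0 p1 p3]
          on_line_cross_exchange[of p0 p2 p3] on_line_cross_rotate[of p1 p2 p3] on_line_cross_exchange[of p1 p2 p3]
        by blast+
      consider "on_line (cross p0 p1) p4" | "on_line (cross p0 p2) p4" | "on_line (cross p0 p3) p4"
        | "\<not> on_line (cross p0 p1) p4" "\<not> on_line (cross p0 p2) p4" "\<not> on_line (cross p0 p3) p4" by blast
      thus ?thesis
      proof cases
        case 1 thus ?thesis using meet[of p1 p2 p3] p1 p2 p3 p4 sym by blast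
      next
        case 2 thus ?thesis using meet[of p2 p1 p3] p1 p2 p3 p4 sym n12 by blast
      next
        case 3 thus ?thesis using meet[of p3 p1 p2] p1 p2 p3 p4 sym n3 by blast
      next
        case 4
        \<comment> \<open>Four distinct lines through \<open>p0\<close>: the star bound gives
          \<open>(3 * 2 + 4) / 4 = 5/2\<close>.\<close>
        let ?S = "{p1, p2, p3, p4}"
        have c: "card ?S = 4" using n12 n3 p4 by auto
        have "real ((card ?S - 1) * mult p0 + sum mult ?S) / real (card ?S) \<le> waldschmidt P mult"
        proof (rule waldschmidt_ge_star)
          have "\<not> on_line (cross p0 p4) p1" "\<not> on_line (cross p0 p4) p2" "\<not> on_line (cross p0 p4) p3"
            using 4 on_line_cross_exchange[of p0 _ p4] by blast+
          thus "\<not> on_line (cross p0 x) y" if "x \<in> ?S" "y \<in> ?S" "x \<noteq> y" for x y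
            using that 4 sym p2(2) p3(2,3) by blast
        next
          show "proj_point (cross p0 x)" if "x \<in> ?S" for x
            using that cross p0(1) p1 p2(1) p3(1) p4 n12 n3 by blast
        qed (use p0 p1 p2 p3 p4 in auto)
        moreover have "sum mult ?S = 4" using n12 n3 p1 p4 m1[OF p1] m1[OF p2(1)] m1[OF p3(1)] m1[OF p4(1)] by auto
        ultimately show ?thesis unfolding c m0 by simp
      qed
    qed
  qed
qed

section \<open>Upper bounds for the three special forms, with the exact value for the third\<close>

lemma (in fat_points) waldschmidt_collinear:
  assumes "proj_point l" "\<And>p. p \<in> P \<Longrightarrow> on_line l p" "\<And>p. p \<in> P \<Longrightarrow> mult p \<le> 2"
  shows "waldschmidt P mult \<le> 2"
proof -
  have "waldschmidt P mult \<le> real (2 * 1) / real 1"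
  proof (rule waldschmidt_le)
    \<comment> \<open>The doubled line is the witness, already for \<open>k = 1\<close>.\<close>
    show "lin l ^ 2 \<noteq> 0" using lin_nonzero[OF assms(1)] poly3_power_eq_0 by blast
    show "homogeneous_of (2 * 1) (lin l ^ 2)" by (intro homogeneous_power homogeneous_lin)
    show "lin l ^ 2 \<in> ideal_pow (point_ideal p) (1 * mult p)" if "p \<in> P" for p
      using assms that by (intro lin_power_in_ideal_pow) auto
  qed simp
  thus ?thesis by simp
qed

text \<open>The witness for \<open>k = 1\<close> is the product of the two lines, which has
  multiplicity 2 where they meet.\<close>

lemma (in fat_points) waldschmidt_two_lines:
  assumes "proj_point L1" "proj_point L2" "on_line L1 p0" "on_line L2 p0" "mult p0 = 2"
    "\<And>p. p \<in> P - {p0} \<Longrightarrow> mult p = 1 \<and> (on_line L1 p \<or> on_line L2 p)"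
  shows "waldschmidt P mult \<le> 2"
proof -
  have "waldschmidt P mult \<le> real (1 + 1) / real 1"
  proof (rule waldschmidt_le)
    show "lin L1 * lin L2 \<noteq> 0" using lin_nonzero assms(1,2) poly3_mult_eq_0 by blast
    show "homogeneous_of (1 + 1) (lin L1 * lin L2)" by (intro homogeneous_mult homogeneous_lin)
    have L: "lin l \<in> ideal_pow (point_ideal p) 1" if "on_line l p" for l p :: "'k pt3"
      using lin_power_in_ideal_pow[OF that, of 1 1] by simp
    show "lin L1 * lin L2 \<in> ideal_pow (point_ideal p) (1 * mult p)" if "p \<in> P" for p
    proof (cases "p = p0")
      case True
      have "lin L1 * lin L2 \<in> ideal_pow (point_ideal p0) (1 + 1)"
        by (intro ideal_pow_mult L assms)
      thus ?thesis using True assms(5) by (simp add: numeral_2_eq_2)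
    next
      case False
      hence "mult p = 1" "on_line L1 p \<or> on_line L2 p" using assms(6) that by auto
      thus ?thesis
        using ideal_pow_lmult[OF L, of L1 p "lin L2"] ideal_pow_lmult[OF L, of L2 p "lin L1"]
        by (auto simp: mult.commute)
    qed
  qed simp
  thus ?thesis by simp
qed

text \<open>For \<open>k = 3\<close> the three lines through \<open>p1\<close>, each doubled,
  together with \<open>l\<close> form a curve of degree 7 with multiplicity 6 at \<open>p1\<close>
  and \<open>2 + 1\<close> at the other points. The star bound with centre \<open>p1\<close> and
  three lines gives \<open>(2 * 2 + 3) / 3\<close> from below.\<close>

lemma (in fat_points) waldschmidt_point_and_three_collinear:
  assumes P: "P = {p1, p2, p3, p4}" "card P = 4"
    and dist: "\<And>p q. p \<in> P \<Longrightarrow> q \<in> P \<Longrightarrow> p \<noteq> q \<Longrightarrow> proj_point (cross p q)"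
    and m: "mult p1 = 2" "mult p2 = 1" "mult p3 = 1" "mult p4 = 1"
    and l: "proj_point l" "on_line l p2" "on_line l p3" "on_line l p4" "\<not> on_line l p1"
  shows "waldschmidt P mult = 7 / 3"
proof (rule antisym)
  have "distinct [p1, p2, p3, p4]" by (rule card_distinct) (use P in simp)
  hence ne: "p1 \<noteq> p2" "p1 \<noteq> p3" "p1 \<noteq> p4" "p2 \<noteq> p3" "p2 \<noteq> p4" "p3 \<noteq> p4" by auto
  let ?g = "\<lambda>p. lin (cross p1 p) ^ 2"
  let ?f = "?g p2 * ?g p3 * ?g p4 * lin l"
  have "waldschmidt P mult \<le> real (2 * 1 + 2 * 1 + 2 * 1 + 1) / real 3"
  proof (rule waldschmidt_le)
    have "?g p \<noteq> 0" if "p \<in> P" "p1 \<noteq> p" for p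
      using lin_nonzero[OF dist[of p1 p]] that P(1) poly3_power_eq_0 by blast
    thus "?f \<noteq> 0" using lin_nonzero[OF l(1)] poly3_mult_eq_0 ne P(1) by blast
    show "homogeneous_of (2 * 1 + 2 * 1 + 2 * 1 + 1) ?f"
      by (intro homogeneous_mult homogeneous_power homogeneous_lin)
    have L: "lin l \<in> ideal_pow (point_ideal p) 1" if "on_line l p" for p
      using lin_power_in_ideal_pow[OF that, of 1 1] by simp
    have g: "h * (?g p * lin l) \<in> ideal_pow (point_ideal p) (2 + 1)" if "on_line l p" for h p
      by (intro ideal_pow_lmult ideal_pow_mult L that lin_power_in_ideal_pow) auto
    have "lin l * (?g p2 * ?g p3 * ?g p4) \<in> ideal_pow (point_ideal p1) (2 + 2 + 2)"
      by (intro ideal_pow_lmult ideal_pow_mult lin_power_in_ideal_pow) auto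
    moreover note g[OF l(2), of "?g p3 * ?g p4"] g[OF l(3), of "?g p2 * ?g p4"] g[OF l(4), of "?g p2 * ?g p3"]
    ultimately show "?f \<in> ideal_pow (point_ideal p) (3 * mult p)" if "p \<in> P" for p
      using that m unfolding P(1) by (auto simp: mult_ac)
  qed simp
  thus "waldschmidt P mult \<le> 7 / 3" by simp
  have "real ((card {p2, p3, p4} - 1) * mult p1 + sum mult {p2, p3, p4}) / real (card {p2, p3, p4})
      \<le> waldschmidt P mult"
  proof (rule waldschmidt_ge_star)
    \<comment> \<open>The line joining \<open>q\<close> and \<open>r\<close> is \<open>l\<close>,
      which misses \<open>p1\<close>; hence the three lines through \<open>p1\<close> are
      distinct.\<close>
    fix q r assume q: "q \<in> {p2, p3, p4}" "r \<in> {p2, p3, p4}" "q \<noteq> r"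
    hence "on_line l p1 \<longleftrightarrow> on_line (cross q r) p1"
      using l P(1) dist by (intro on_line_iff_cross) auto
    thus "\<not> on_line (cross p1 q) r" using l(5) on_line_cross_rotate by blast
  next
    show "proj_point (cross p1 q)" if "q \<in> {p2, p3, p4}" for q
      using that dist[of p1 q] ne P(1) by blast
  qed (use P(1) in auto)
  thus "7 / 3 \<le> waldschmidt P mult" using ne m by simp
qed

theorem theoremB:
  fixes P :: "'k::field pt3 set" and mult :: "'k pt3 \<Rightarrow> nat"
  assumes finP: "finite P" and neP: "P \<noteq> {}"
    and pts: "\<forall>p\<in>P. proj_point p"
    and dist: "\<forall>p\<in>P. \<forall>q\<in>P. p \<noteq> q \<longrightarrow> \<not> proj_eq p q"
    and pos: "\<forall>p\<in>P. mult p \<ge> 1"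
    and nonred: "\<exists>p\<in>P. mult p \<ge> 2"
  defines "formA \<equiv> (\<forall>p\<in>P. mult p \<le> 2) \<and>
                    (\<exists>l. proj_point l \<and> (\<forall>p\<in>P. on_line l p))"
      and "formB \<equiv> (\<exists>p0\<in>P. \<exists>L1 L2. proj_point L1 \<and> proj_point L2 \<and> \<not> proj_eq L1 L2 \<and>
                    on_line L1 p0 \<and> on_line L2 p0 \<and> mult p0 = 2 \<and>
                    (\<forall>p\<in>P - {p0}. mult p = 1 \<and> (on_line L1 p \<or> on_line L2 p)) \<and>
                    (\<exists>p\<in>P - {p0}. on_line L1 p) \<and> (\<exists>p\<in>P - {p0}. on_line L2 p))"
      and "formC \<equiv> (\<exists>p1 p2 p3 p4 l. P = {p1, p2, p3, p4} \<and> card P = 4 \<and>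
                    mult p1 = 2 \<and> mult p2 = 1 \<and> mult p3 = 1 \<and> mult p4 = 1 \<and>
                    proj_point l \<and> on_line l p2 \<and> on_line l p3 \<and> on_line l p4 \<and>
                    \<not> on_line l p1)"
  shows "(waldschmidt P mult < 5/2 \<longleftrightarrow> formA \<or> formB \<or> formC)
       \<and> (formA \<longrightarrow> waldschmidt P mult = 2)
       \<and> (formB \<longrightarrow> waldschmidt P mult = 2)
       \<and> (formC \<longrightarrow> waldschmidt P mult = 7/3)"
proof -
  interpret fat_points P mult by unfold_locales (rule finP)
  obtain p0 where p0: "p0 \<in> P" "mult p0 \<ge> 2" using nonred by blast
  \<comment> \<open>One double point already forces the value to be at least 2, matching the upper
    bounds for forms (a) and (b).\<close>
  have "real (mult p0) \<le> waldschmidt P mult" using waldschmidt_ge_mult p0(1) pts by blast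
  hence ge2: "2 \<le> waldschmidt P mult" using p0(2) by linarith
  have A: "waldschmidt P mult = 2" if formA
    using waldschmidt_collinear that ge2 unfolding formA_def by (metis antisym)
  have B: "waldschmidt P mult = 2" if formB
    using waldschmidt_two_lines that ge2 unfolding formB_def by (metis antisym)
  have C: "waldschmidt P mult = 7 / 3" if formC
  proof -
    have "proj_point (cross p q)" if "p \<in> P" "q \<in> P" "p \<noteq> q" for p q
      using proj_eqI_cross pts dist that by blast
    thus ?thesis
      using that waldschmidt_point_and_three_collinear unfolding formC_def by metis
  qed
  have "5 / 2 \<le> waldschmidt P mult" if n: "\<not> formA" "\<not> formB" "\<not> formC"
  proof (rule waldschmidt_ge_five_halves[OF _ _ _ p0])
    show "\<exists>p\<in>P. \<not> on_line l p" if "\<forall>p\<in>P. mult p \<le> 2" "proj_point l" for l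
      using n(1) that unfolding formA_def by blast
    show "\<exists>p\<in>P - {p0}. \<not> on_line L1 p \<and> \<not> on_line L2 p"
      if "mult p0 = 2" "\<forall>p\<in>P - {p0}. mult p = 1" "proj_point L1" "proj_point L2" "\<not> proj_eq L1 L2"
        "on_line L1 p0" "on_line L2 p0" "p1 \<in> P - {p0}" "on_line L1 p1" "p2 \<in> P - {p0}" "on_line L2 p2"
      for L1 L2 p1 p2
      using n(2) that p0(1) unfolding formB_def by blast
    show "P \<noteq> {p0, p1, p2, p3}"
      if c: "mult p0 = 2" "\<forall>p\<in>P - {p0}. mult p = 1" "card {p0, p1, p2, p3} = 4" "proj_point l"
        "on_line l p1" "on_line l p2" "on_line l p3" "\<not> on_line l p0" for p1 p2 p3 l
    proof
      assume P: "P = {p0, p1, p2, p3}"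
      have "p1 \<noteq> p0" "p2 \<noteq> p0" "p3 \<noteq> p0" using c(5-8) by auto
      hence "mult p1 = 1" "mult p2 = 1" "mult p3 = 1" using c(2) P by auto
      hence formC unfolding formC_def using P c by blast
      thus False using n(3) by blast
    qed
  qed (use pts dist pos in auto)
  \<comment> \<open>The values 2, 2 and \<open>7/3\<close> are all below \<open>5/2\<close>, which
    gives one direction; the lower bound just proved is the contrapositive of the other.\<close>
  thus ?thesis using A B C by fastforce
qed

end
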